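(* Let $\Bbbk$ be an algebraically closed field of characteristic zero, let $n\ge2$ and $d\geq3$. For every reduced pair $(c,q)$ of degrees $(n,d)$ belonging to $\Omega_{n,d}=\{(c,q)\mid q_{00}\,q_{01}\,q_{10}\neq0\}$, every simple derivation $D\in\operatorname{Der}_{\Bbbk}(A_{c,q})$ satisfies $\operatorname{Aut}_D(A_{c,q})=\{\operatorname{id}\}$.
   Context: A reduced pair $(c,q)$ of degrees $(n,d)$ consists of $c(x)=\sum_{r=0}^{n}c_rx^r\in\Bbbk[x]$ with $c_n\neq0$, $c_{n-1}=0$, and $q(x,y)=\lambda y^d+\sum_{0\le i<n,\ 0\le j\le d-2}q_{ij}x^iy^j\in\Bbbk[x,y]$ with $\lambda\in\Bbbk^*$. $A_{c,q}=\Bbbk[x,y,z]/(c(x)z-q(x,y))$. $\operatorname{Der}_{\Bbbk}(A)$ is the space of $\Bbbk$-derivations of $A$; a derivation $D$ of $A$ is simple if the only ideals $I\subseteq A$ with $D(I)\subseteq I$ are $0$ and $A$; $\operatorname{Aut}_D(A)$ is the group of $\Bbbk$-algebra automorphisms $\sigma$ of $A$ with $\sigma D=D\sigma$. *)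

theory Defs
  imports "HOL-Algebra.Algebra" "HOL-Algebra.Algebraic_Closure_Type"
    "HOL-Computational_Algebra.Computational_Algebra"
begin

text \<open>
  Polynomial rings are nested univariate ones: \<open>\<k>[x]\<close> is \<open>'k poly\<close>, \<open>\<k>[x,y]\<close> is
  \<open>'k poly poly\<close> (polynomials in \<open>y\<close> over \<open>\<k>[x]\<close>), and \<open>\<k>[x,y,z]\<close> is
  \<open>'k poly poly poly\<close> (polynomials in \<open>z\<close> over \<open>\<k>[x,y]\<close>).
  Hence the coefficient of \<open>x\<^sup>i y\<^sup>j\<close> in \<open>q\<close> is \<open>coeff (coeff q j) i\<close>.
\<close>

definition coeff_xy :: "'k::zero poly poly \<Rightarrow> nat \<Rightarrow> nat \<Rightarrow> 'k" where
  "coeff_xy q i j = coeff (coeff q j) i"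

text \<open>The bound \<open>j < d - 1\<close> renders \<open>j \<le> d - 2\<close>, correctly also for \<open>d < 2\<close>.\<close>

definition reduced_pair :: "nat \<Rightarrow> nat \<Rightarrow> 'k::field poly \<Rightarrow> 'k poly poly \<Rightarrow> bool" where
  "reduced_pair n d c q \<longleftrightarrow>
     degree c = n \<and> coeff c n \<noteq> 0 \<and> coeff c (n - 1) = 0 \<and>
     (\<exists>l a. l \<noteq> 0 \<and>
        q = monom [:l:] d + (\<Sum>i<n. \<Sum>j<d - 1. monom (monom (a i j) i) j))"

definition Omega :: "nat \<Rightarrow> nat \<Rightarrow> ('k::field poly \<times> 'k poly poly) set" where
  "Omega n d = {(c, q). reduced_pair n d c q \<and>
     coeff_xy q 0 0 * coeff_xy q 0 1 * coeff_xy q 1 0 \<noteq> 0}"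

definition surface_relation ::
    "'k::field poly \<Rightarrow> 'k poly poly \<Rightarrow> 'k poly poly poly" where
  "surface_relation c q = [:[:c:]:] * [:0, 1:] - [:q:]"

definition surface_ideal ::
    "'k::field poly \<Rightarrow> 'k poly poly \<Rightarrow> 'k poly poly poly set" where
  "surface_ideal c q = PIdl\<^bsub>ring_of_type_algebra\<^esub> (surface_relation c q)"

definition surface_ring ::
    "'k::field poly \<Rightarrow> 'k poly poly \<Rightarrow> 'k poly poly poly set ring" where
  "surface_ring c q = ring_of_type_algebra Quot surface_ideal c q"

definition surface_const ::
    "'k::field poly \<Rightarrow> 'k poly poly \<Rightarrow> 'k \<Rightarrow> 'k poly poly poly set" where
  "surface_const c q a = surface_ideal c q +>\<^bsub>ring_of_type_algebra\<^esub> [:[:[:a:]:]:]"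

text \<open>
  A \<open>\<k>\<close>-algebra is given by a ring \<open>A\<close> together with its structure map \<open>\<iota>\<close> from \<open>\<k>\<close> to \<open>A\<close>.
  Maps of \<open>A\<close> to itself are taken extensional, so that equality of maps is equality on the carrier.
\<close>

definition derivations :: "('a, 'm) ring_scheme \<Rightarrow> ('k \<Rightarrow> 'a) \<Rightarrow> ('a \<Rightarrow> 'a) set" where
  "derivations A \<iota> = {D \<in> carrier A \<rightarrow>\<^sub>E carrier A.
     (\<forall>f\<in>carrier A. \<forall>g\<in>carrier A. D (f \<oplus>\<^bsub>A\<^esub> g) = D f \<oplus>\<^bsub>A\<^esub> D g) \<and>
     (\<forall>a. \<forall>f\<in>carrier A. D (\<iota> a \<otimes>\<^bsub>A\<^esub> f) = \<iota> a \<otimes>\<^bsub>A\<^esub> D f) \<and>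
     (\<forall>f\<in>carrier A. \<forall>g\<in>carrier A.
        D (f \<otimes>\<^bsub>A\<^esub> g) = (D f \<otimes>\<^bsub>A\<^esub> g) \<oplus>\<^bsub>A\<^esub> (f \<otimes>\<^bsub>A\<^esub> D g))}"

definition simple_derivation :: "('a, 'm) ring_scheme \<Rightarrow> ('a \<Rightarrow> 'a) \<Rightarrow> bool" where
  "simple_derivation A D \<longleftrightarrow>
     (\<forall>I. ideal I A \<and> D ` I \<subseteq> I \<longrightarrow> I = {\<zero>\<^bsub>A\<^esub>} \<or> I = carrier A)"

definition algebra_auts :: "('a, 'm) ring_scheme \<Rightarrow> ('k \<Rightarrow> 'a) \<Rightarrow> ('a \<Rightarrow> 'a) set" where
  "algebra_auts A \<iota> = {\<sigma> \<in> ring_iso A A \<inter> extensional (carrier A). \<forall>a. \<sigma> (\<iota> a) = \<iota> a}"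

definition isotropy :: "('a, 'm) ring_scheme \<Rightarrow> ('k \<Rightarrow> 'a) \<Rightarrow> ('a \<Rightarrow> 'a) \<Rightarrow> ('a \<Rightarrow> 'a) set" where
  "isotropy A \<iota> D = {\<sigma> \<in> algebra_auts A \<iota>. \<forall>f\<in>carrier A. \<sigma> (D f) = D (\<sigma> f)}"

end

theory Submission
  imports Defs
begin

text \<open>
  Write \<open>A = \<k>[x,y,z]/(c z - q)\<close>. Since \<open>z = q/c\<close>, \<open>A\<close> sits inside \<open>K[y]\<close> for any field
  \<open>K\<close> containing \<open>\<k>(x)\<close>. Here \<open>K\<close> is the field \<open>\<k>((t))\<close> of Laurent series in \<open>t = 1/x\<close>,
  where the degree in \<open>x\<close>, leading coefficients and \<open>x d/dx\<close> can be read off coefficientwise. As \<open>q\<close> has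
  the constant leading coefficient \<open>l\<close> in \<open>y\<close>, each element of \<open>A\<close> has a normal form
  \<open>\<Sum>\<^sub>i r\<^sub>i z\<^sup>i\<close> with \<open>r\<^sub>i \<in> \<k>[x,y]\<close> of \<open>y\<close>-degree below \<open>d\<close>. The nonzero terms have distinct \<open>y\<close>-degrees, so
  the map \<open>A \<rightarrow> K[y]\<close> is injective, and ordering monomials by \<open>y\<close>-degree first and \<open>x\<close>-degree
  second, every leading monomial \<open>x\<^sup>i y\<^sup>j\<close> of an element of \<open>A\<close> satisfies \<open>i \<ge> - n \<lfloor>j/d\<rfloor>\<close>
  (\<open>phi_eq_0_iff\<close>, \<open>M_cone\<close>).

  Let \<open>\<sigma>\<close> be an automorphism. It preserves \<open>\<k>[x]\<close>, by an argument of Makar-Limanov. The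
  derivation \<open>c \<partial>/\<partial>y\<close> is locally nilpotent on \<open>A\<close> and kills \<open>x\<close>, so its conjugate \<open>\<partial>\<close> by \<open>\<sigma>\<close> is
  locally nilpotent and kills \<open>\<sigma>(x)\<close>. On leading monomials \<open>\<partial>\<close> acts as
  \<open>x\<^sup>i y\<^sup>j \<mapsto> (\<alpha> i + \<beta> j) x\<^sup>i\<^sup>+\<^sup>p y\<^sup>j\<^sup>+\<^sup>r\<close> for some exponents \<open>(p,r)\<close>. Nilpotency on \<open>x\<close>, \<open>y\<close> and \<open>z\<close> makes \<open>\<alpha>\<close>
  and \<open>\<beta>\<close> natural multiples of a common scalar. If \<open>\<sigma>(x)\<close> involved \<open>y\<close>, then \<open>\<alpha> i + \<beta> j\<close> would vanish
  at its leading exponents, which forces \<open>\<alpha> : \<beta> = d : n\<close>; for \<open>n, d \<ge> 2\<close> no such \<open>(p,r)\<close> is compatible with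
  the bound on leading monomials (\<open>cone_arithmetic\<close>, \<open>nilpotent_kernel_degree\<close>).

  Consequently \<open>\<sigma>(x) = a x + b\<close> and \<open>\<sigma>(y) = \<mu> y + p(x)\<close>. Applying \<open>\<sigma>\<close> to \<open>c z = q\<close> shows that
  \<open>c(a x + b)\<close> is a scalar multiple of \<open>c\<close>, whence \<open>b = 0\<close> because \<open>c\<^sub>n\<^sub>-\<^sub>1 = 0\<close>; that \<open>c\<close> divides \<open>p\<close>,
  because \<open>q\<close> has no term in \<open>y\<^sup>d\<^sup>-\<^sup>1\<close>; and that \<open>\<mu>\<^sup>d q\<^sub>i\<^sub>j = a\<^sup>i \<mu>\<^sup>j q\<^sub>i\<^sub>j\<close> for \<open>j < d\<close>. With
  \<open>q\<^sub>0\<^sub>0\<close>, \<open>q\<^sub>0\<^sub>1\<close> and \<open>q\<^sub>1\<^sub>0\<close> nonzero this gives \<open>a = \<mu> = 1\<close>: the automorphism is the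
  shift \<open>x \<mapsto> x\<close>, \<open>y \<mapsto> y + c h\<close> for some \<open>h \<in> \<k>[x]\<close> (\<open>aut_is_shift\<close>).

  Only now does the simple derivation \<open>D\<close>, commuting with \<open>\<sigma>\<close>, enter. Suppose \<open>h \<noteq> 0\<close>. Then
  \<open>D x\<close> is fixed by the shift, so it is a polynomial \<open>w(x)\<close>. If \<open>w = 0\<close>, the ideal \<open>(x)\<close> is stable under
  \<open>D\<close>; otherwise \<open>(w)\<close> is, as \<open>D w = w' w\<close>. Simplicity therefore makes \<open>w\<close> a nonzero
  constant. Finally \<open>\<sigma>(D y) - D y = D (c h) = w (c h)'\<close> forces \<open>D y = v\<^sub>1 y + v\<^sub>0\<close> with
  \<open>v\<^sub>1 c h = w (c h)'\<close>, which is impossible by degree. Hence \<open>h = 0\<close> and \<open>\<sigma> = id\<close>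
  (\<open>model_isotropy_trivial\<close>).
\<close>

unbundle fps_syntax

section \<open>Homomorphisms out of polynomial rings\<close>

definition ring_map :: "('a::comm_ring_1 \<Rightarrow> 'b::comm_ring_1) \<Rightarrow> bool" where
  "ring_map h \<longleftrightarrow> h 1 = 1 \<and> (\<forall>a b. h (a + b) = h a + h b) \<and> (\<forall>a b. h (a * b) = h a * h b)"

definition eval_hom :: "('a::comm_ring_1 \<Rightarrow> 'b::comm_ring_1) \<Rightarrow> 'b \<Rightarrow> 'a poly \<Rightarrow> 'b" where
  "eval_hom h b p = poly (map_poly h p) b"

lemma ring_mapD:
  assumes "ring_map h"
  shows "h 1 = 1" "h (a + b) = h a + h b" "h (a * b) = h a * h b"
    "h 0 = 0" "h (- a) = - h a" "h (a - b) = h a - h b"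
proof -
  show add: "h (a + b) = h a + h b" and "h 1 = 1" and "h (a * b) = h a * h b" for a b
    using assms by (auto simp: ring_map_def)
  have "h 0 + h 0 = h 0 + 0" using add[of 0 0] by simp
  then show z: "h 0 = 0" by (simp only: add_left_cancel)
  have m: "h (- a) = - h a" for a
  proof -
    have "h a + h (- a) = 0" using add[of a "- a"] z by simp
    then show ?thesis by (simp add: eq_neg_iff_add_eq_0 add.commute)
  qed
  show "h (- a) = - h a" by (rule m)
  show "h (a - b) = h a - h b" using add[of a "- b"] m[of b] by simp
qed

lemma eval_hom_pCons: "ring_map h \<Longrightarrow> eval_hom h b (pCons a p) = h a + b * eval_hom h b p"
  by (simp add: eval_hom_def map_poly_pCons ring_mapD)

lemma eval_hom_0: "eval_hom h b 0 = 0"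
  by (simp add: eval_hom_def)

lemma ring_map_eval_hom:
  assumes h: "ring_map h"
  shows "ring_map (eval_hom h b)"
proof -
  have add: "eval_hom h b (p + r) = eval_hom h b p + eval_hom h b r" for p r
    by (induction p r rule: poly_induct2) (simp_all add: eval_hom_0 eval_hom_pCons h ring_mapD algebra_simps)
  have sm: "eval_hom h b (smult a p) = h a * eval_hom h b p" for a p
    by (induction p) (simp_all add: eval_hom_0 eval_hom_pCons h ring_mapD algebra_simps)
  have "eval_hom h b (p * r) = eval_hom h b p * eval_hom h b r" for p r
    by (induction p) (simp_all add: eval_hom_0 eval_hom_pCons h ring_mapD add sm algebra_simps)
  moreover have "eval_hom h b 1 = 1"
    by (simp add: one_pCons eval_hom_pCons eval_hom_0 h ring_mapD)
  ultimately show ?thesis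
    by (simp add: ring_map_def add)
qed

lemma ring_map_map_poly:
  assumes h: "ring_map h"
  shows "ring_map (map_poly h)"
proof -
  have cf: "coeff (map_poly h p) i = h (coeff p i)" for p i
    by (simp add: coeff_map_poly ring_mapD h)
  have sum: "h (\<Sum>i\<in>A. g i) = (\<Sum>i\<in>A. h (g i))" for g and A :: "nat set"
    by (induction A rule: infinite_finite_induct) (simp_all add: ring_mapD h)
  show ?thesis
    unfolding ring_map_def
    by (auto simp: poly_eq_iff cf coeff_mult sum ring_mapD h map_poly_1')
qed

definition ring_derivation :: "('a::comm_ring_1 \<Rightarrow> 'a) \<Rightarrow> bool" where
  "ring_derivation \<delta> \<longleftrightarrow>
     (\<forall>a b. \<delta> (a + b) = \<delta> a + \<delta> b) \<and> (\<forall>a b. \<delta> (a * b) = \<delta> a * b + a * \<delta> b)"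

lemma coeff_mult_degree_le:
  fixes f g :: "'a::idom poly"
  assumes "degree f \<le> i" "degree g \<le> j"
  shows "coeff (f * g) (i + j) = coeff f i * coeff g j"
proof (cases "degree f = i \<and> degree g = j")
  case True
  then show ?thesis by (auto simp: coeff_mult_degree_sum)
next
  case False
  then have "degree f < i \<or> degree g < j" using assms by auto
  moreover have "degree (f * g) < i + j"
    using degree_mult_le[of f g] assms False by linarith
  ultimately show ?thesis by (auto simp: coeff_eq_0)
qed

section \<open>Linear substitutions\<close>

lemma coeff_linear_mult:
  fixes Q :: "'a::comm_ring_1 poly"
  shows "coeff ([:b, a:] * Q) j = b * coeff Q j + (case j of 0 \<Rightarrow> 0 | Suc i \<Rightarrow> a * coeff Q i)"
  by (simp split: nat.split)

text \<open>
  The two highest coefficients of \<open>P(a y + b)\<close>. They serve to normalise the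
  image of \<open>x\<close> (from \<open>c\<close>) and of \<open>y\<close> (from \<open>q\<close>), and to bound the degree of a polynomial that a
  shift changes only by a constant. The bound on \<open>degree P\<close> is an inequality so that the induction on \<open>P\<close> goes through.
\<close>

lemma coeff_pcompose_linear_top:
  fixes P :: "'a::idom poly"
  assumes "degree P \<le> N"
  shows "coeff (pcompose P [:b, a:]) N = a ^ N * coeff P N"
  using assms
proof (induction P arbitrary: N)
  case 0
  then show ?case by simp
next
  case (pCons e P)
  show ?case
  proof (cases N)
    case 0
    then have "P = 0" using pCons.prems by (auto split: if_splits)
    then show ?thesis using 0 by simp
  next
    case (Suc M)
    then have dP: "degree P \<le> M" using pCons.prems by (auto split: if_splits)
    have "degree (pcompose P [:b, a:]) \<le> degree P * degree [:b, a:]"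
      by (rule degree_pcompose_le)
    also have "\<dots> \<le> degree P * 1" by (intro mult_left_mono) auto
    finally have "coeff (pcompose P [:b, a:]) (Suc M) = 0"
      using dP by (intro coeff_eq_0) auto
    then show ?thesis
      using pCons.IH[OF dP] by (simp add: pcompose_pCons coeff_linear_mult Suc coeff_pCons)
  qed
qed

lemma coeff_pcompose_linear_subtop:
  fixes P :: "'a::idom poly"
  assumes "degree P \<le> Suc N"
  shows "coeff (pcompose P [:b, a:]) N = a ^ N * (coeff P N + of_nat (Suc N) * b * coeff P (Suc N))"
  using assms
proof (induction P arbitrary: N)
  case 0
  then show ?case by simp
next
  case (pCons e P)
  then have dP: "degree P \<le> N" by (auto split: if_splits)
  have *: "coeff (pcompose P [:b, a:]) N = a ^ N * coeff P N"
    by (rule coeff_pcompose_linear_top[OF dP])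
  show ?case
  proof (cases N)
    case 0
    then show ?thesis using * by (simp add: pcompose_pCons algebra_simps)
  next
    case (Suc M)
    have "coeff (pcompose P [:b, a:]) M
      = a ^ M * (coeff P M + of_nat (Suc M) * b * coeff P (Suc M))"
      using pCons.IH dP Suc by simp
    then show ?thesis
      using * by (simp add: pcompose_pCons coeff_linear_mult Suc coeff_pCons algebra_simps)
  qed
qed

text \<open>Modulo \<open>b\<close>, substituting \<open>a y + b\<close> is the diagonal substitution \<open>y \<mapsto> a y\<close>.\<close>

lemma dvd_coeff_pcompose_linear:
  fixes P :: "'a::comm_ring_1 poly"
  shows "b dvd coeff (pcompose P [:b, a:]) j - a ^ j * coeff P j"
proof (induction P arbitrary: j)
  case 0
  then show ?case by simp
next
  case (pCons e P)
  show ?case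
  proof (cases j)
    case 0
    then show ?thesis by (simp add: pcompose_pCons)
  next
    case (Suc i)
    have "coeff (pcompose (pCons e P) [:b, a:]) j - a ^ j * coeff (pCons e P) j
      = b * coeff (pcompose P [:b, a:]) j + a * (coeff (pcompose P [:b, a:]) i - a ^ i * coeff P i)"
      by (simp add: pcompose_pCons coeff_linear_mult Suc algebra_simps)
    then show ?thesis using pCons.IH[of i] by (simp add: dvd_add dvd_mult)
  qed
qed

section \<open>Polynomials as Laurent series at infinity\<close>

text \<open>
  The field containing \<open>\<k>(x)\<close> is \<open>\<k>((t))\<close> with \<open>x = 1/t\<close>. The degree in \<open>x\<close> of an element is
  minus its subdegree, and the coefficient of \<open>x\<^sup>i\<close> is the one with index \<open>- i\<close>.
\<close>

definition emb :: "'k::field poly \<Rightarrow> 'k fls" where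
  "emb = eval_hom fls_const fls_X_inv"

lemma ring_map_fls_const: "ring_map (fls_const :: 'k::field \<Rightarrow> 'k fls)"
  by (simp add: ring_map_def fls_plus_const)

lemma ring_map_emb: "ring_map emb"
  unfolding emb_def by (rule ring_map_eval_hom[OF ring_map_fls_const])

lemmas emb_hom = ring_mapD[OF ring_map_emb]

lemma emb_pCons: "emb (pCons a p) = fls_const a + fls_X_inv * emb p"
  unfolding emb_def by (rule eval_hom_pCons[OF ring_map_fls_const])

lemma emb_const [simp]: "emb [:a:] = fls_const a"
  by (simp add: emb_pCons emb_hom(4))

lemma emb_X [simp]: "emb [:0, 1:] = fls_X_inv"
  by (simp add: emb_pCons emb_hom(4))

lemma emb_nth: "emb p $$ m = (if m \<le> 0 then coeff p (nat (- m)) else 0)"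
proof (induction p arbitrary: m)
  case 0
  then show ?case by (simp add: emb_hom(4))
next
  case (pCons a p)
  have "nat (- m) = Suc (nat (- (m + 1)))" if "m < 0" using that by simp
  then show ?case using pCons.IH[of "m + 1"]
    by (cases "m < 0") (auto simp: emb_pCons fls_X_inv_times_conv_shift coeff_pCons split: nat.splits)
qed

lemma emb_inj: "emb p = emb r \<longleftrightarrow> p = r"
proof
  assume eq: "emb p = emb r"
  show "p = r"
  proof (rule poly_eqI)
    fix i
    show "coeff p i = coeff r i"
      using arg_cong[OF eq, of "\<lambda>f. f $$ (- int i)"] by (simp add: emb_nth)
  qed
qed simp

lemma emb_eq_0_iff [simp]: "emb p = 0 \<longleftrightarrow> p = 0"
  using emb_inj[of p 0] by (simp add: emb_hom(4))

lemma subdegree_emb: "fls_subdegree (emb p) = - int (degree p)"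
proof (cases "p = 0")
  case False
  show ?thesis
  proof (rule fls_subdegree_eqI)
    show "emb p $$ (- int (degree p)) \<noteq> 0" using False by (simp add: emb_nth)
  next
    fix m assume "m < - int (degree p)"
    then show "emb p $$ m = 0" by (simp add: emb_nth coeff_eq_0)
  qed
qed (simp add: emb_hom(4))

definition iota :: "'k::field poly poly \<Rightarrow> 'k fls poly" where
  "iota = map_poly emb"

lemma ring_map_iota: "ring_map iota"
  unfolding iota_def by (rule ring_map_map_poly[OF ring_map_emb])

lemmas iota_hom = ring_mapD[OF ring_map_iota]

lemma coeff_iota: "coeff (iota p) j = emb (coeff p j)"
  by (simp add: iota_def coeff_map_poly emb_hom)

lemma iota_inj: "iota p = iota r \<longleftrightarrow> p = r"
  by (simp add: poly_eq_iff[of "iota p"] coeff_iota emb_inj poly_eq_iff[symmetric])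

lemma degree_iota: "degree (iota p) = degree p"
  unfolding iota_def by (rule degree_map_poly) simp

lemma iota_pCons: "iota (pCons a p) = pCons (emb a) (iota p)"
  by (simp add: iota_def map_poly_pCons emb_hom)

lemma iota_0 [simp]: "iota 0 = 0"
  by (simp add: iota_def)

section \<open>Leading monomials and derivations\<close>

text \<open>
  Monomials \<open>x\<^sup>i y\<^sup>j\<close> are ordered by \<open>j\<close> first and \<open>i\<close> second. The predicate says that no monomial
  of \<open>f\<close> exceeds \<open>x\<^sup>i y\<^sup>j\<close> and that this one has coefficient \<open>a\<close>. The value \<open>a = 0\<close> is allowed on
  purpose: leading coefficients may cancel, and with this convention they still add and multiply
  without case distinctions.
\<close>

definition leads :: "'k::field fls poly \<Rightarrow> int \<Rightarrow> nat \<Rightarrow> 'k \<Rightarrow> bool" where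
  "leads f i j a \<longleftrightarrow>
     degree f \<le> j \<and> (\<forall>m < - i. coeff f j $$ m = 0) \<and> coeff f j $$ (- i) = a"

lemma leads_0: "leads 0 i j a \<longleftrightarrow> a = 0"
  by (auto simp: leads_def)

lemma leads_add: "leads f i j a \<Longrightarrow> leads g i j b \<Longrightarrow> leads (f + g) i j (a + b)"
  by (simp add: leads_def degree_add_le)

lemma fls_nth_mult_bound:
  fixes f g :: "'k::field fls"
  assumes f: "\<forall>m < M. f $$ m = 0" and g: "\<forall>m < N. g $$ m = 0"
  shows "m < M + N \<Longrightarrow> (f * g) $$ m = 0" and "(f * g) $$ (M + N) = f $$ M * g $$ N"
proof -
  have "(m < M + N \<longrightarrow> (f * g) $$ m = 0) \<and> (f * g) $$ (M + N) = f $$ M * g $$ N"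
  proof (cases "f = 0 \<or> g = 0")
    case False
    then have sf: "fls_subdegree f \<ge> M" and sg: "fls_subdegree g \<ge> N"
      using f g by (auto intro: fls_subdegree_geI)
    show ?thesis
    proof (cases "fls_subdegree f = M \<and> fls_subdegree g = N")
      case True
      then show ?thesis by (auto simp: fls_times_nth_eq0)
    next
      case ne: False
      then have "M < fls_subdegree f \<or> N < fls_subdegree g" using sf sg by linarith
      then have "f $$ M * g $$ N = 0" by (metis fls_eq0_below_subdegree mult_zero_left mult_zero_right)
      moreover have "M + N < fls_subdegree f + fls_subdegree g" using ne sf sg by linarith
      ultimately show ?thesis by (simp add: fls_times_nth_eq0)
    qed
  qed auto
  then show "m < M + N \<Longrightarrow> (f * g) $$ m = 0" and "(f * g) $$ (M + N) = f $$ M * g $$ N"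
    by auto
qed

lemma leads_mult:
  assumes "leads f i j a" "leads g i' j' b"
  shows "leads (f * g) (i + i') (j + j') (a * b)"
proof -
  have f: "degree f \<le> j" "\<forall>m < - i. coeff f j $$ m = 0" "coeff f j $$ (- i) = a"
    and g: "degree g \<le> j'" "\<forall>m < - i'. coeff g j' $$ m = 0" "coeff g j' $$ (- i') = b"
    using assms by (simp_all add: leads_def)
  have c: "coeff (f * g) (j + j') = coeff f j * coeff g j'"
    by (rule coeff_mult_degree_le[OF f(1) g(1)])
  have "degree (f * g) \<le> j + j'"
    using degree_mult_le[of f g] f(1) g(1) by linarith
  moreover have "- (i + i') = - i + - i'" by simp
  ultimately show ?thesis
    using fls_nth_mult_bound[OF f(2) g(2)] f(3) g(3) unfolding leads_def c by metis
qed

lemma leads_exact: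
  assumes "leads f i j a" "a \<noteq> 0"
  shows "degree f = j" "fls_subdegree (lead_coeff f) = - i" "f \<noteq> 0"
proof -
  have "coeff f j \<noteq> 0" using assms by (auto simp: leads_def)
  then show d: "degree f = j" using assms le_degree by (fastforce simp: leads_def)
  show "fls_subdegree (lead_coeff f) = - i"
    unfolding d using assms by (intro fls_subdegree_eqI) (auto simp: leads_def)
  show "f \<noteq> 0" using assms by (auto simp: leads_0)
qed

lemma leads_exists:
  assumes "f \<noteq> 0"
  shows "\<exists>a. a \<noteq> 0 \<and> leads f (- fls_subdegree (lead_coeff f)) (degree f) a"
  using assms by (intro exI[of _ "lead_coeff f $$ fls_subdegree (lead_coeff f)"])
    (auto simp: leads_def)

text \<open>
  The derivation \<open>x d/dx\<close> of \<open>\<k>((t))\<close>, written in terms of \<open>t = 1/x\<close>. It is preferred to \<open>d/dx\<close>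
  because it multiplies each monomial by its exponent and so does not move leading monomials.
\<close>

definition euler :: "'k::field fls \<Rightarrow> 'k fls" where
  "euler r = - (fls_X * fls_deriv r)"

lemma euler_nth: "euler r $$ m = - of_int m * r $$ m"
  by (simp add: euler_def fls_X_times_conv_shift)

lemma euler_add: "euler (r + s) = euler r + euler s"
  by (simp add: euler_def algebra_simps)

lemma euler_mult: "euler (r * s) = euler r * s + r * euler s"
  by (simp add: euler_def algebra_simps)

lemma euler_const [simp]: "euler (fls_const a) = 0" "euler 0 = 0"
  by (simp_all add: euler_def)

lemma euler_X_inv [simp]: "euler fls_X_inv = fls_X_inv"
  by (rule fls_eqI) (auto simp: euler_nth)

lemma coeff_map_euler: "coeff (map_poly euler f) j = euler (coeff f j)"
  by (simp add: coeff_map_poly)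

lemma derivation_map_euler: "ring_derivation (map_poly euler)"
proof -
  have sum: "euler (\<Sum>i\<in>A. g i) = (\<Sum>i\<in>A. euler (g i))" for g and A :: "nat set"
    by (induction A rule: infinite_finite_induct) (simp_all add: euler_add)
  show ?thesis
    unfolding ring_derivation_def
    by (auto simp: poly_eq_iff coeff_map_euler euler_add coeff_mult sum euler_mult sum.distrib)
qed

text \<open>
  With \<open>U = u/x\<close> this is the derivation \<open>f \<mapsto> (\<partial>f/\<partial>x) u + (\<partial>f/\<partial>y) v\<close>, which sends \<open>x\<close> to \<open>u\<close>
  and \<open>y\<close> to \<open>v\<close>.
\<close>

definition xy_der :: "'k::field fls poly \<Rightarrow> 'k fls poly \<Rightarrow> 'k fls poly \<Rightarrow> 'k fls poly" where
  "xy_der U v f = map_poly euler f * U + pderiv f * v"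

lemma derivation_xy_der: "ring_derivation (xy_der U v)"
proof -
  have "map_poly euler (a + b) = map_poly euler a + map_poly euler b"
    and "map_poly euler (a * b) = map_poly euler a * b + a * map_poly euler b" for a b :: "'a fls poly"
    using derivation_map_euler unfolding ring_derivation_def by blast+
  then show ?thesis
    by (simp add: ring_derivation_def xy_der_def pderiv_add pderiv_mult algebra_simps)
qed

lemma leads_map_euler: "leads f i j a \<Longrightarrow> leads (map_poly euler f) i j (of_int i * a)"
  by (auto simp: leads_def coeff_map_euler euler_nth coeff_eq_0 intro!: degree_le)

text \<open>
  The degree \<open>(p, r)\<close> of the derivation is that of \<open>U\<close> and, after dividing by \<open>y\<close>, that of \<open>v\<close>.
  Having \<open>Suc r\<close> as \<open>y\<close>-exponent of \<open>v\<close> keeps \<open>r\<close> a natural number; this is possible whenever \<open>U\<close> is nonzero.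
\<close>

lemma leads_xy_der:
  assumes f: "leads f i j a" and U: "leads U p r \<alpha>" and v: "leads v p (Suc r) \<beta>"
  shows "leads (xy_der U v f) (i + p) (j + r) (a * (of_int i * \<alpha> + of_nat j * \<beta>))"
proof -
  have 1: "leads (map_poly euler f * U) (i + p) (j + r) (of_int i * a * \<alpha>)"
    by (intro leads_mult leads_map_euler f U)
  have 2: "leads (pderiv f * v) (i + p) (j + r) (of_nat j * a * \<beta>)"
  proof (cases j)
    case 0
    then have "degree f = 0" using f by (simp add: leads_def)
    then have "pderiv f = 0" by (auto simp: pderiv_pCons elim!: degree_eq_zeroE)
    then show ?thesis using 0 by (simp add: leads_0)
  next
    case (Suc k)
    have "leads (pderiv f) i k (of_nat j * a)"
      using f Suc by (auto simp: leads_def coeff_pderiv coeff_eq_0 fls_of_nat intro!: degree_le)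
    from leads_mult[OF this v] show ?thesis using Suc by (simp add: algebra_simps)
  qed
  show ?thesis
    using leads_add[OF 1 2] by (simp add: xy_der_def algebra_simps)
qed

lemma leads_xy_der_funpow:
  assumes f: "leads f i j a" and U: "leads U p r \<alpha>" and v: "leads v p (Suc r) \<beta>"
  shows "leads ((xy_der U v ^^ m) f) (i + int m * p) (j + m * r)
    (a * (\<Prod>s<m. of_int (i + int s * p) * \<alpha> + of_nat (j + s * r) * \<beta>))"
proof (induction m)
  case 0
  then show ?case using f by simp
next
  case (Suc m)
  from leads_xy_der[OF this U v] show ?case by (simp add: algebra_simps)
qed

text \<open>
  Iterating multiplies the leading coefficient of \<open>f\<close> by successive values of the weight
  \<open>\<alpha> i + \<beta> j\<close>, which grows by the constant \<open>p \<alpha> + r \<beta>\<close> at each step. If an iterate vanishes, one of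
  these values is zero.
\<close>

lemma nilpotent_weight_eq:
  assumes f: "leads f i j a" "a \<noteq> 0" and U: "leads U p r \<alpha>" and v: "leads v p (Suc r) \<beta>"
    and nil: "(xy_der U v ^^ m) f = 0"
  obtains s :: nat where "of_int i * \<alpha> + of_nat j * \<beta> = of_nat s * - (of_int p * \<alpha> + of_nat r * \<beta>)"
proof -
  have "(\<Prod>s<m. of_int (i + int s * p) * \<alpha> + of_nat (j + s * r) * \<beta>) = 0"
    using leads_xy_der_funpow[OF f(1) U v, of m] f(2) by (simp add: nil leads_0)
  then obtain s where "of_int (i + int s * p) * \<alpha> + of_nat (j + s * r) * \<beta> = 0"
    by auto
  then have "of_int i * \<alpha> + of_nat j * \<beta> = of_nat s * - (of_int p * \<alpha> + of_nat r * \<beta>)"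
    by (simp add: algebra_simps eq_neg_iff_add_eq_0)
  then show thesis by (rule that)
qed

text \<open>
  Take for \<open>(p, r)\<close> the larger of the leading exponents of \<open>U\<close> and of \<open>v/y\<close>; then at least one of
  the two leading coefficients survives.
\<close>

lemma xy_der_leads_exists:
  assumes "U \<noteq> 0"
  obtains p r \<alpha> \<beta> where "leads U p r \<alpha>" "leads v p (Suc r) \<beta>" "\<alpha> \<noteq> 0 \<or> \<beta> \<noteq> 0"
proof -
  define p where "p = - fls_subdegree (lead_coeff U)"
  define r where "r = degree U"
  obtain \<alpha> where \<alpha>: "\<alpha> \<noteq> 0" "leads U p r \<alpha>"
    using leads_exists[OF assms] unfolding p_def r_def by blast
  show thesis
  proof (cases "\<exists>\<beta>. leads v p (Suc r) \<beta>")
    case True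
    then show ?thesis using \<alpha> that by blast
  next
    case False
    then have "v \<noteq> 0" by (auto simp: leads_0)
    define p' where "p' = - fls_subdegree (lead_coeff v)"
    obtain \<beta> where \<beta>: "\<beta> \<noteq> 0" "leads v p' (degree v) \<beta>"
      using leads_exists[OF \<open>v \<noteq> 0\<close>] unfolding p'_def by blast
    have "\<not> degree v < Suc r"
    proof
      assume "degree v < Suc r"
      then have "leads v p (Suc r) 0" by (simp add: leads_def coeff_eq_0)
      then show False using False by blast
    qed
    then obtain r' where r': "degree v = Suc r'" "r \<le> r'"
      by (cases "degree v") auto
    have "p < p'" if "r' = r"
    proof (rule ccontr)
      assume "\<not> p < p'"
      then have "leads v p (Suc r) (coeff v (Suc r) $$ (- p))"
        using \<beta>(2) r' that by (auto simp: leads_def)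
      then show False using False by blast
    qed
    then have "leads U p' r' 0"
      using \<alpha>(2) r'(2) by (cases "r' = r") (auto simp: leads_def coeff_eq_0)
    then show ?thesis using \<beta> r' that by metis
  qed
qed

section \<open>No derivation degree compatible with the cone\<close>

text \<open>
  The numbers \<open>s1\<close>, \<open>s2\<close>, \<open>s3\<close> are the weights of \<open>x\<close>, \<open>y\<close> and \<open>z\<close> in units in which the derivation
  lowers the weight by one, and \<open>(i0, j0)\<close> is the leading exponent of an element of weight zero that
  involves \<open>y\<close>. If \<open>s1 = 0\<close> that element forces \<open>s2 = 0\<close>, contradicting the equation \<open>e\<close>. Otherwise the weight is
  nonnegative on the cone generated by \<open>x\<close> and \<open>z\<close> and vanishes at a point other than the origin,
  so \<open>z\<close> has weight zero and \<open>s1 : s2 = d : n\<close>. Then \<open>d p + n r < 0\<close>, although the images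
  of \<open>x\<close> and \<open>y\<close> must have exponents in the cone; rounding in \<open>r div d\<close> leaves no room since
  \<open>(n - 1) (d - 1) \<ge> 1\<close>.
\<close>

lemma cone_arithmetic:
  fixes n d s1 s2 s3 j0 r :: nat and p i0 :: int
  assumes n: "n \<ge> 2" and d: "d \<ge> 2" and j0: "j0 \<ge> 1"
    and e: "int s1 * p + int s2 * int r = - 1"
    and z: "- int n * int s1 + int d * int s2 = int s3"
    and x: "i0 * int s1 + int j0 * int s2 = 0"
    and i0: "i0 \<ge> - int n * int (j0 div d)"
    and u: "s1 \<noteq> 0 \<Longrightarrow> p + 1 \<ge> - int n * int (r div d)"
    and v: "s2 \<noteq> 0 \<Longrightarrow> p \<ge> - int n * int (Suc r div d)"
  shows False
proof (cases "s1 = 0")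
  case True
  then have "s2 = 0" using x j0 by simp
  then show False using e True by simp
next
  case False
  (* i0 and j0 bound s2/s1 from above by n/d, and the weight of z bounds it from below *)
  have "int d * int (j0 div d) \<le> int j0"
    by (metis of_nat_le_iff of_nat_mult times_div_less_eq_dividend)
  then have "int n * (int d * int (j0 div d)) \<le> int n * int j0"
    by (rule mult_left_mono) simp
  moreover have "int d * i0 \<ge> int d * (- int n * int (j0 div d))"
    using i0 by (rule mult_left_mono) simp
  ultimately have "- (int d * i0) \<le> int n * int j0" by (simp add: algebra_simps)
  then have "- (int d * i0) * int s1 \<le> int n * int j0 * int s1"
    by (rule mult_right_mono) simp
  moreover have "- (int d * i0) * int s1 = int d * (int j0 * int s2)"
  proof -
    have "- (i0 * int s1) = int j0 * int s2" using x by linarith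
    then show ?thesis by (metis (no_types, opaque_lifting) mult.assoc mult_minus_left mult_minus_right)
  qed
  ultimately have "int j0 * (int d * int s2) \<le> int j0 * (int n * int s1)"
    by (simp add: algebra_simps)
  then have "int d * int s2 \<le> int n * int s1" using j0 by simp
  then have eq: "int d * int s2 = int n * int s1" using z by linarith
  then have s2: "s2 \<noteq> 0" using False n by (intro notI) simp
  have "int s1 * (int d * p + int n * int r) = int d * (int s1 * p) + (int n * int s1) * int r"
    by (simp add: algebra_simps)
  also have "\<dots> = int d * (int s1 * p + int s2 * int r)"
    by (simp add: eq[symmetric] algebra_simps)
  also have "\<dots> < 0" using e d by simp
  finally have neg: "int d * p + int n * int r < 0"
    by (simp add: mult_less_0_iff)
  show False
  proof (cases "d dvd Suc r")
    case True
    (* only here do r and r + 1 have different quotients by d, so the bound from x is the one to use *)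
    then obtain k where k: "Suc r = d * k" by blast
    then have "k \<noteq> 0" by (intro notI) simp
    then obtain m where m: "k = Suc m" by (cases k) auto
    have r: "r = d * m + (d - 1)" using k m d by simp
    then have "r div d = m" using d by (intro div_nat_eqI) auto
    then have "p + 1 \<ge> - int n * int m" using u False by simp
    then have "int d * (p + 1) \<ge> int d * (- int n * int m)" by (rule mult_left_mono) simp
    moreover have "int r = int d * int m + int d - 1" using r d by (simp add: of_nat_diff)
    then have "int n * int r = int n * (int d * int m + int d - 1)" by simp
    ultimately have "int d * p + int n * int r \<ge> int n * int d - int d - int n"
      by (simp add: algebra_simps)
    moreover have "(int n - 1) * (int d - 1) \<ge> 1 * 1"
      using n d by (intro mult_mono) auto
    ultimately show False using neg by (simp add: algebra_simps)
  next
    case False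
    then have "Suc r div d = r div d" by (simp add: div_Suc dvd_eq_mod_eq_0)
    then have "p \<ge> - int n * int (r div d)" using v s2 by simp
    then have "int d * p \<ge> int d * (- int n * int (r div d))" by (rule mult_left_mono) simp
    moreover have "int n * (int d * int (r div d)) \<le> int n * int r"
      by (rule mult_left_mono) (metis of_nat_le_iff of_nat_mult times_div_less_eq_dividend, simp)
    ultimately show False using neg by (simp add: algebra_simps)
  qed
qed

section \<open>The surface inside polynomials over Laurent series\<close>

text \<open>
  The consequences of reducedness that drive the argument, with \<open>l\<close> the leading coefficient of \<open>q\<close> in \<open>y\<close>.
\<close>

locale danielewski =
  fixes n d :: nat and c :: "'k::field_char_0 poly" and q :: "'k poly poly" and l :: 'k
  assumes n2: "n \<ge> 2" and d2: "d \<ge> 2"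
    and deg_c: "degree c = n" and subtop_c: "coeff c (n - 1) = 0"
    and deg_q: "degree q = d" and top_q: "coeff q d = [:l:]" and l_nz: "l \<noteq> 0"
    and subtop_q: "coeff q (d - 1) = 0"
    and deg_coeff_q: "\<And>j. j < d \<Longrightarrow> degree (coeff q j) < n"
begin

text \<open>
  The images of \<open>x\<close>, \<open>y\<close>, \<open>c\<close>, \<open>z\<close> and of a scalar in \<open>\<k>((t))[y]\<close>. The ring \<open>M\<close> is the isomorphic copy of
  the coordinate ring in which all computations take place.
\<close>

definition xx :: "'k fls poly" where "xx = [:fls_X_inv:]"
definition yy :: "'k fls poly" where "yy = [:0, 1:]"
definition cc :: "'k fls poly" where "cc = [:emb c:]"
definition zz :: "'k fls poly" where "zz = smult (inverse (emb c)) (iota q)"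
definition scal :: "'k \<Rightarrow> 'k fls poly" where "scal a = [:fls_const a:]"

definition phi :: "'k poly poly poly \<Rightarrow> 'k fls poly" where "phi = eval_hom iota zz"
definition M :: "'k fls poly set" where "M = range phi"

lemma c_nz [simp]: "c \<noteq> 0"
  using deg_c n2 by auto

lemma ring_map_phi: "ring_map phi"
  unfolding phi_def by (rule ring_map_eval_hom[OF ring_map_iota])

lemmas phi_hom = ring_mapD[OF ring_map_phi]

lemma phi_pCons: "phi (pCons p P) = iota p + zz * phi P"
  unfolding phi_def by (rule eval_hom_pCons[OF ring_map_iota])

lemma phi_const [simp]: "phi [:p:] = iota p"
  by (simp add: phi_pCons phi_hom(4))

lemma cc_mult_zz: "cc * zz = iota q"
  by (simp add: cc_def zz_def)

lemma iota_const: "iota [:r:] = [:emb r:]"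
  by (simp add: iota_pCons)

lemma gens: "phi [:[:[:a:]:]:] = scal a" "phi [:[:[:0, 1:]:]:] = xx" "phi [:[:0, 1:]:] = yy"
  "phi [:0, 1:] = zz" "phi [:[:c:]:] = cc"
  by (simp_all add: scal_def xx_def yy_def cc_def iota_pCons phi_pCons phi_hom(4) emb_hom(1) iota_hom(1))

lemma phi_relation [simp]: "phi (surface_relation c q) = 0"
  unfolding surface_relation_def phi_hom(6) phi_hom(3) gens cc_mult_zz by simp

lemma iota_in_M: "iota p \<in> M"
  unfolding M_def by (metis phi_const rangeI)

lemma M_closed: "f \<in> M \<Longrightarrow> g \<in> M \<Longrightarrow> f + g \<in> M" "f \<in> M \<Longrightarrow> g \<in> M \<Longrightarrow> f * g \<in> M"
    "f \<in> M \<Longrightarrow> g \<in> M \<Longrightarrow> f - g \<in> M" "0 \<in> M" "1 \<in> M"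
proof -
  show "f + g \<in> M" "f * g \<in> M" "f - g \<in> M" if "f \<in> M" "g \<in> M" for f g
    using that unfolding M_def by (auto simp: phi_hom(2,3,6)[symmetric])
  show "0 \<in> M" "1 \<in> M"
    unfolding M_def using phi_hom(1,4) by (metis rangeI)+
qed

lemma gens_in_M [simp, intro]: "scal a \<in> M" "xx \<in> M" "yy \<in> M" "zz \<in> M" "cc \<in> M"
  unfolding M_def gens[symmetric] by (rule rangeI)+

lemma emb_in_M: "[:emb r:] \<in> M"
  using iota_in_M[of "[:r:]"] by (simp add: iota_const)

subsection \<open>Normal forms\<close>

definition normal_form :: "'k poly poly poly \<Rightarrow> bool" where
  "normal_form R \<longleftrightarrow> (\<forall>k. degree (coeff R k) < d)"

lemma normal_add: "normal_form P \<Longrightarrow> normal_form R \<Longrightarrow> normal_form (P + R)"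
  by (simp add: normal_form_def degree_add_less)

lemma normal_pCons: "normal_form (pCons p R) \<longleftrightarrow> degree p < d \<and> normal_form R"
  by (auto simp: normal_form_def coeff_pCons split: nat.splits)

lemma normal_0: "normal_form 0"
  using d2 by (simp add: normal_form_def)

lemma normal_smult: "normal_form R \<Longrightarrow> normal_form (smult [:r:] R)"
  by (auto simp: normal_form_def intro: le_less_trans[OF degree_smult_le])

text \<open>
  Long division in \<open>y\<close>, possible over \<open>\<k>[x]\<close> since the leading coefficient of \<open>q\<close> is a scalar.
  The degree of the quotient is recorded because it drives the recursion below.
\<close>

lemma divide_by_q:
  "\<exists>s r. p = q * s + r \<and> degree r < d \<and> (degree p \<ge> d \<longrightarrow> s = 0 \<or> degree s < degree p)"
proof (induction "degree p" arbitrary: p rule: less_induct)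
  case less
  show ?case
  proof (cases "degree p < d")
    case True
    then show ?thesis by (intro exI[of _ 0] exI[of _ p]) auto
  next
    case False
    define t where "t = monom (smult (inverse l) (lead_coeff p)) (degree p - d)"
    define p' where "p' = p - q * t"
    have p0: "degree p \<noteq> 0" "p \<noteq> 0" using False d2 by auto
    have lt: "lead_coeff p \<noteq> 0" using p0 by simp
    then have dt: "degree t = degree p - d"
      using l_nz by (simp add: t_def degree_monom_eq)
    have dqt: "degree (q * t) \<le> degree p"
      using degree_mult_le[of q t] deg_q dt False by simp
    have "coeff (q * t) (d + (degree p - d)) = coeff q d * coeff t (degree p - d)"
      by (rule coeff_mult_degree_le) (simp_all add: deg_q dt)
    then have "coeff (q * t) (degree p) = lead_coeff p"
      using False l_nz by (simp add: top_q t_def)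
    then have "coeff p' (degree p) = 0" by (simp add: p'_def)
    moreover have "degree p' \<le> degree p" unfolding p'_def using dqt by (intro degree_diff_le) simp_all
    ultimately have "degree p' < degree p" using p0
      by (metis degree_0 leading_coeff_0_iff order_le_less)
    from less.hyps[OF this] obtain s r where
      sr: "p' = q * s + r" "degree r < d" "degree p' \<ge> d \<longrightarrow> s = 0 \<or> degree s < degree p'"
      by blast
    have ds: "degree s < degree p"
    proof (cases "degree p' \<ge> d")
      case True
      then show ?thesis using sr(3) \<open>degree p' < degree p\<close> p0 by auto
    next
      case False
      have "s = 0"
      proof (rule ccontr)
        assume "s \<noteq> 0"
        then have "degree (q * s) = d + degree s" using deg_q d2 by (subst degree_mult_eq) auto
        moreover have "q * s = p' - r" using sr(1) by simp
        then have "degree (q * s) < d" using sr(2) False by (simp add: degree_diff_less)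
        ultimately show False by simp
      qed
      then show ?thesis using p0 by simp
    qed
    have "p = q * (s + t) + r" using sr(1) by (simp add: p'_def algebra_simps)
    moreover have "degree (s + t) < degree p" using ds dt d2 p0 False
      by (intro degree_add_less) auto
    ultimately show ?thesis using sr(2) by blast
  qed
qed

text \<open>
  Expand \<open>p\<close> in powers of \<open>q\<close> by repeated division, replacing each \<open>q\<close> by \<open>c z\<close>.
\<close>

lemma normal_exists_const: "\<exists>R. normal_form R \<and> surface_relation c q dvd [:p:] - R"
proof (induction "degree p" arbitrary: p rule: less_induct)
  case less
  show ?case
  proof (cases "degree p < d")
    case True
    then show ?thesis by (intro exI[of _ "[:p:]"]) (simp add: normal_pCons normal_0)
  next
    case False
    obtain s r where sr: "p = q * s + r" "degree r < d" "s = 0 \<or> degree s < degree p"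
      using divide_by_q[of p] False by auto
    have "degree s < degree p" using sr(3) False d2 by auto
    from less.hyps[OF this] obtain S where S: "normal_form S" "surface_relation c q dvd [:s:] - S" by blast
    define R where "R = [:r:] + pCons 0 (smult [:c:] S)"
    have "normal_form R" unfolding R_def
      using sr(2) S(1) d2 by (intro normal_add) (auto simp: normal_pCons normal_0 normal_smult)
    moreover have "[:p:] - R = [:[:c:]:] * [:0, 1:] * ([:s:] - S) - surface_relation c q * [:s:]"
      by (simp add: R_def sr(1) surface_relation_def smult_diff_right algebra_simps)
    ultimately show ?thesis using S(2) by (metis dvd_diff dvd_mult dvd_triv_left)
  qed
qed

lemma normal_exists: "\<exists>R. normal_form R \<and> surface_relation c q dvd P - R"
proof (induction P)
  case 0
  then show ?case using normal_0 by (intro exI[of _ 0]) simp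
next
  case (pCons p P)
  obtain R where R: "normal_form R" "surface_relation c q dvd P - R" using pCons.IH by blast
  obtain S where S: "normal_form S" "surface_relation c q dvd [:p:] - S" using normal_exists_const by blast
  have "normal_form (S + pCons 0 R)" using R S d2 by (intro normal_add) (auto simp: normal_pCons)
  moreover have "pCons p P - (S + pCons 0 R) = ([:p:] - S) + [:0, 1:] * (P - R)"
    by (simp add: algebra_simps)
  ultimately show ?case using R(2) S(2) by (metis dvd_add dvd_mult)
qed

lemma zz_top: "degree zz = d" "coeff zz d = fls_const l * inverse (emb c)"
  by (simp_all add: zz_def degree_iota deg_q coeff_iota top_q)

text \<open>
  The image \<open>q/c\<close> of \<open>z\<close> has \<open>y\<close>-degree exactly \<open>d\<close>, while the coefficients of a normal form have
  smaller \<open>y\<close>-degree. Hence the terms of a normal form cannot cancel and the one of highest \<open>z\<close>-degree leads.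
\<close>

lemma phi_normal_top:
  assumes "normal_form R" "R \<noteq> 0"
  shows "degree (phi R) = d * degree R + degree (lead_coeff R) \<and>
    lead_coeff (phi R) = emb (lead_coeff (lead_coeff R)) * (fls_const l * inverse (emb c)) ^ degree R"
  using assms
proof (induction R)
  case 0
  then show ?case by simp
next
  case (pCons r R)
  have normal_form: "degree r < d" "normal_form R" using pCons.prems by (auto simp: normal_pCons)
  show ?case
  proof (cases "R = 0")
    case True
    then show ?thesis by (simp add: degree_iota coeff_iota)
  next
    case False
    note IH = pCons.IH[OF normal_form(2) False]
    have "lead_coeff (phi R) \<noteq> 0" unfolding conjunct2[OF IH] using False l_nz by simp
    then have nz: "phi R \<noteq> 0" by auto
    have dz: "degree (zz * phi R) = d + degree (phi R)"
      using nz zz_top d2 by (subst degree_mult_eq) auto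
    have lt: "degree (iota r) < degree (zz * phi R)" using normal_form dz by (simp add: degree_iota)
    then have dg: "degree (phi (pCons r R)) = degree (zz * phi R)"
      by (simp add: phi_pCons degree_add_eq_right)
    have "lead_coeff (phi (pCons r R)) = lead_coeff (zz * phi R)"
      unfolding phi_pCons by (rule lead_coeff_add_le[OF lt])
    also have "\<dots> = lead_coeff zz * lead_coeff (phi R)" by (rule lead_coeff_mult)
    also have "\<dots> = emb (lead_coeff (lead_coeff R)) * (fls_const l * inverse (emb c)) ^ Suc (degree R)"
      unfolding conjunct2[OF IH] zz_top by simp
    finally show ?thesis
      using dg dz conjunct1[OF IH] False by simp
  qed
qed

lemma phi_normal_eq_0:
  assumes "normal_form R" "phi R = 0"
  shows "R = 0"
proof (rule ccontr)
  assume "R \<noteq> 0"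
  from conjunct2[OF phi_normal_top[OF assms(1) this]] this show False
    unfolding assms(2) using l_nz by simp
qed

lemma phi_eq_0_iff: "phi P = 0 \<longleftrightarrow> surface_relation c q dvd P"
proof
  assume "surface_relation c q dvd P"
  then obtain Q where "P = surface_relation c q * Q" by (rule dvdE)
  then show "phi P = 0" by (simp only: phi_hom(3) phi_relation mult_zero_left)
next
  assume P: "phi P = 0"
  obtain R where R: "normal_form R" "surface_relation c q dvd P - R" using normal_exists by blast
  then obtain Q where "P - R = surface_relation c q * Q" by (elim dvdE)
  then have "phi (P - R) = 0" by (simp only: phi_hom(3) phi_relation mult_zero_left)
  then have "phi R = 0" using P by (simp add: phi_hom(6))
  then have "R = 0" using phi_normal_eq_0 R(1) by blast
  then show "surface_relation c q dvd P" using R by simp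
qed

lemma M_normal:
  assumes "f \<in> M"
  obtains R where "normal_form R" "f = phi R"
proof -
  obtain P where P: "f = phi P" using assms by (auto simp: M_def)
  obtain R where R: "normal_form R" "surface_relation c q dvd P - R" using normal_exists by blast
  then have "phi (P - R) = 0" by (simp add: phi_eq_0_iff)
  then show thesis using R P that by (simp add: phi_hom(6))
qed

lemma M_low_degree:
  assumes "f \<in> M" "degree f < d"
  obtains r where "f = iota r"
proof -
  obtain R where R: "normal_form R" "f = phi R" using M_normal assms by blast
  have "degree R = 0"
  proof (cases "R = 0")
    case False
    have "d * degree R < d * 1"
      using conjunct1[OF phi_normal_top[OF R(1) False]] assms(2) unfolding R(2) by linarith
    then show ?thesis using mult_less_cancel1 by (metis less_one)
  qed simp
  then obtain r where "R = [:r:]" by (auto elim: degree_eq_zeroE)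
  then show thesis using R that by simp
qed

lemma M_degree_0:
  assumes "f \<in> M" "degree f = 0"
  obtains r where "f = [:emb r:]"
proof -
  have "degree f < d" using assms(2) d2 by simp
  then obtain r where r: "f = iota r" by (rule M_low_degree[OF assms(1)])
  then have "degree r = 0" using assms by (simp add: degree_iota)
  then obtain a where "r = [:a:]" by (auto elim: degree_eq_zeroE)
  then show thesis using r that by (simp add: iota_const)
qed

lemma M_degree_d:
  assumes "f \<in> M" "degree f = d"
  obtains r g where "degree r < d" "f = iota r + [:emb g:] * zz"
proof -
  obtain R where R: "normal_form R" "f = phi R" using M_normal assms by blast
  have "R \<noteq> 0" using R assms d2 by (auto simp: phi_hom(4))
  then have e: "d = d * degree R + degree (lead_coeff R)"
    using conjunct1[OF phi_normal_top[OF R(1)]] assms(2) unfolding R(2) by linarith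
  moreover have lt: "degree (lead_coeff R) < d" using R by (simp add: normal_form_def)
  ultimately have "d = d * degree R" using mod_mult_self2_is_0 
    by (metis add_cancel_right_right mod_less mod_mult_self4 mod_self)
  then have dR: "degree R = 1" using d2 by simp
  then have "degree (coeff R 1) = 0" using e by simp
  then obtain g where g: "coeff R 1 = [:g:]" by (rule degree_eq_zeroE)
  have rg: "R = [:coeff R 0, [:g:]:]"
  proof (rule poly_eqI)
    fix i show "coeff R i = coeff [:coeff R 0, [:g:]:] i"
    proof (cases "i \<le> 1")
      case True
      then show ?thesis using g by (cases i) auto
    next
      case False
      then show ?thesis using dR by (simp add: coeff_eq_0)
    qed
  qed
  have "phi R = iota (coeff R 0) + [:emb g:] * zz"
    by (subst rg) (simp add: phi_pCons iota_const mult.commute phi_hom(4))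
  moreover have "degree (coeff R 0) < d" using R by (simp add: normal_form_def)
  ultimately show thesis using that R(2) by metis
qed

text \<open>
  In a normal form the leading term is \<open>r z\<^sup>k\<close> with \<open>k = j div d\<close>, and dividing by \<open>c\<^sup>k\<close> lowers the
  \<open>x\<close>-degree of the polynomial \<open>r\<close> by \<open>n k\<close>.
\<close>

lemma M_cone:
  assumes "f \<in> M" "leads f i j a" "a \<noteq> 0"
  shows "i \<ge> - int n * int (j div d)"
proof -
  obtain R where R: "normal_form R" "f = phi R" using M_normal assms by blast
  have "R \<noteq> 0" using R leads_exact(3)[OF assms(2,3)] by (auto simp: phi_hom(4))
  note top = phi_normal_top[OF R(1) this, folded R(2)]
  have "degree (lead_coeff R) < d" using R by (simp add: normal_form_def)
  moreover have "j = d * degree R + degree (lead_coeff R)"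
    using conjunct1[OF top] leads_exact(1)[OF assms(2,3)] by simp
  ultimately have "j div d = degree R" by simp
  moreover have "- i = fls_subdegree (emb (lead_coeff (lead_coeff R)) * (fls_const l * inverse (emb c)) ^ degree R)"
    unfolding conjunct2[OF top, symmetric] by (rule leads_exact(2)[OF assms(2,3), symmetric])
  then have "- i = - int (degree (lead_coeff (lead_coeff R))) + int (degree R) * int n"
    using \<open>R \<noteq> 0\<close> l_nz
    by (simp add: subdegree_emb fls_subdegree_pow deg_c fls_inverse_subdegree)
  ultimately show ?thesis by (simp add: mult.commute)
qed

subsection \<open>Derivations and automorphisms of the model\<close>

lemma scal_0: "scal 0 = 0"
  by (simp add: scal_def)

lemma emb_split: "[:emb (pCons a r):] = scal a + xx * [:emb r:]"
  by (simp add: scal_def xx_def emb_pCons)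

lemma iota_split: "iota (pCons r p) = [:emb r:] + yy * iota p"
  by (simp add: yy_def iota_pCons)

lemma iota_induct:
  assumes "\<And>a. Q (scal a)" "Q xx" "Q yy"
    and add: "\<And>f g. f \<in> M \<Longrightarrow> g \<in> M \<Longrightarrow> Q f \<Longrightarrow> Q g \<Longrightarrow> Q (f + g)"
    and mult: "\<And>f g. f \<in> M \<Longrightarrow> g \<in> M \<Longrightarrow> Q f \<Longrightarrow> Q g \<Longrightarrow> Q (f * g)"
  shows "Q (iota p)"
proof -
  have Q0: "Q 0" using assms(1)[of 0] by (simp add: scal_0)
  have e: "Q [:emb r:]" for r
  proof (induction r)
    case 0
    then show ?case using Q0 by (simp add: emb_hom(4))
  next
    case (pCons a r)
    then show ?case unfolding emb_split
      by (intro add mult assms M_closed gens_in_M emb_in_M)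
  qed
  show ?thesis
  proof (induction p)
    case 0
    then show ?case using Q0 by simp
  next
    case (pCons r p)
    then show ?case unfolding iota_split
      by (intro add mult assms M_closed gens_in_M emb_in_M iota_in_M e)
  qed
qed

lemma M_induct:
  assumes f: "f \<in> M" and Q: "\<And>a. Q (scal a)" "Q xx" "Q yy" "Q zz"
    and add: "\<And>f g. f \<in> M \<Longrightarrow> g \<in> M \<Longrightarrow> Q f \<Longrightarrow> Q g \<Longrightarrow> Q (f + g)"
    and mult: "\<And>f g. f \<in> M \<Longrightarrow> g \<in> M \<Longrightarrow> Q f \<Longrightarrow> Q g \<Longrightarrow> Q (f * g)"
  shows "Q f"
proof -
  have i: "Q (iota p)" for p using Q(1-3) add mult by (rule iota_induct)
  have "Q (phi P)" for P
  proof (induction P)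
    case 0
    then show ?case using i[of 0] by (simp add: phi_hom(4))
  next
    case (pCons p P)
    then show ?case unfolding phi_pCons
      by (intro add mult Q i M_closed gens_in_M iota_in_M) (auto simp: M_def)
  qed
  then show ?thesis using f by (auto simp: M_def)
qed

text \<open>
  Derivations and automorphisms are functions on the whole of \<open>\<k>((t))[y]\<close> of which only the restriction to
  \<open>M\<close> matters.
\<close>

definition is_der :: "('k fls poly \<Rightarrow> 'k fls poly) \<Rightarrow> bool" where
  "is_der D \<longleftrightarrow> (\<forall>f\<in>M. D f \<in> M) \<and> (\<forall>f\<in>M. \<forall>g\<in>M. D (f + g) = D f + D g) \<and>
     (\<forall>f\<in>M. \<forall>g\<in>M. D (f * g) = D f * g + f * D g) \<and> (\<forall>a. D (scal a) = 0)"

lemma is_derD: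
  assumes "is_der D"
  shows "f \<in> M \<Longrightarrow> D f \<in> M" "f \<in> M \<Longrightarrow> g \<in> M \<Longrightarrow> D (f + g) = D f + D g"
    "f \<in> M \<Longrightarrow> g \<in> M \<Longrightarrow> D (f * g) = D f * g + f * D g" "D (scal a) = 0"
  using assms by (auto simp: is_der_def)

text \<open>
  A derivation is determined by the images of \<open>x\<close> and \<open>y\<close>: applying it to \<open>c z = q\<close> yields \<open>c\<close> times the image
  of \<open>z\<close>, and \<open>c\<close> can be cancelled.
\<close>

lemma is_der_eq_xy_der:
  assumes D: "is_der D" and f: "f \<in> M"
  shows "D f = xy_der (smult fls_X (D xx)) (D yy) f"
proof -
  define E where "E = xy_der (smult fls_X (D xx)) (D yy)"
  have E: "E (f + g) = E f + E g" "E (f * g) = E f * g + f * E g" for f g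
    using derivation_xy_der unfolding E_def ring_derivation_def by blast+
  have C: "E (scal a) = 0" for a
    by (simp add: E_def xy_der_def scal_def map_poly_pCons pderiv_pCons)
  have "fls_X * fls_X_inv = (1::'k fls)" by (simp add: fls_X_times_conv_shift)
  then have X: "E xx = D xx"
    by (simp add: E_def xy_der_def xx_def map_poly_pCons pderiv_pCons)
  have "euler (1::'k fls) = 0" using euler_const(1)[of 1] by simp
  then have Y: "E yy = D yy"
    by (simp add: E_def xy_der_def yy_def map_poly_pCons pderiv_pCons)
  have i: "D (iota p) = E (iota p)" for p
    by (rule iota_induct[where Q = "\<lambda>f. D f = E f"]) (simp_all add: is_derD[OF D] E C X Y)
  have cc: "D cc = E cc" using i[of "[:c:]"] by (simp add: iota_const cc_def)
  have "D cc * zz + cc * D zz = E cc * zz + cc * E zz"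
    using i[of q] unfolding cc_mult_zz[symmetric] by (simp add: is_derD(3)[OF D] E)
  then have "cc * D zz = cc * E zz" using cc by simp
  moreover have "cc \<noteq> 0" by (simp add: cc_def)
  ultimately have Z: "D zz = E zz" by simp
  have "D f = E f"
    by (rule M_induct[OF f, where Q = "\<lambda>f. D f = E f"]) (simp_all add: is_derD[OF D] E C X Y Z)
  then show ?thesis by (simp add: E_def)
qed

text \<open>The inverse \<open>s'\<close> is carried along so that every statement about \<open>s\<close> applies to it as well.\<close>

definition is_aut :: "('k fls poly \<Rightarrow> 'k fls poly) \<Rightarrow> ('k fls poly \<Rightarrow> 'k fls poly) \<Rightarrow> bool" where
  "is_aut s s' \<longleftrightarrow> (\<forall>f\<in>M. s f \<in> M \<and> s' f \<in> M \<and> s' (s f) = f \<and> s (s' f) = f) \<and>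
     (\<forall>f\<in>M. \<forall>g\<in>M. s (f + g) = s f + s g \<and> s (f * g) = s f * s g) \<and> (\<forall>a. s (scal a) = scal a)"

lemma is_autD:
  assumes "is_aut s s'"
  shows "f \<in> M \<Longrightarrow> s f \<in> M" "f \<in> M \<Longrightarrow> s' f \<in> M" "f \<in> M \<Longrightarrow> s' (s f) = f" "f \<in> M \<Longrightarrow> s (s' f) = f"
    "f \<in> M \<Longrightarrow> g \<in> M \<Longrightarrow> s (f + g) = s f + s g" "f \<in> M \<Longrightarrow> g \<in> M \<Longrightarrow> s (f * g) = s f * s g"
    "s (scal a) = scal a"
  using assms by (auto simp: is_aut_def)

lemma is_aut_sym:
  assumes "is_aut s s'"
  shows "is_aut s' s"
proof -
  note A = is_autD[OF assms]
  have "s' (f + g) = s' f + s' g \<and> s' (f * g) = s' f * s' g" if f: "f \<in> M" and g: "g \<in> M" for f g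
  proof
    have M: "s' f \<in> M" "s' g \<in> M" using f g A(2) by blast+
    have "s (s' f + s' g) = f + g" "s (s' f * s' g) = f * g"
      using A(5,6)[OF M] A(4)[OF f] A(4)[OF g] by simp_all
    then show "s' (f + g) = s' f + s' g" "s' (f * g) = s' f * s' g"
      using A(3)[of "s' f + s' g"] A(3)[of "s' f * s' g"] M_closed(1,2)[OF M] by simp_all
  qed
  moreover have "s' (scal a) = scal a" for a
    using A(3)[of "scal a"] by (simp add: A(7))
  ultimately show ?thesis unfolding is_aut_def using A(1-4) by simp
qed

lemma is_aut_0: "is_aut s s' \<Longrightarrow> s 0 = 0"
  using is_autD(7)[of s s' 0] by (simp add: scal_0)

lemma is_aut_emb:
  assumes A: "is_aut s s'" and X: "s xx = [:emb \<xi>:]"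
  shows "s [:emb r:] = [:emb (pcompose r \<xi>):]"
proof (induction r)
  case 0
  then show ?case by (simp add: is_aut_0[OF A] emb_hom(4))
next
  case (pCons a r)
  have "s [:emb (pCons a r):] = scal a + [:emb \<xi>:] * [:emb (pcompose r \<xi>):]"
    unfolding emb_split using pCons.IH X
    by (simp only: is_autD[OF A] gens_in_M emb_in_M M_closed)
  then show ?case by (simp add: scal_def pcompose_pCons emb_hom)
qed

lemma is_aut_iota:
  assumes A: "is_aut s s'" and X: "s xx = [:emb \<xi>:]" and Y: "s yy = iota \<eta>"
  shows "s (iota p) = iota (pcompose (map_poly (\<lambda>r. pcompose r \<xi>) p) \<eta>)"
proof (induction p)
  case 0
  then show ?case by (simp add: is_aut_0[OF A])
next
  case (pCons r p)
  have "s (iota (pCons r p)) = [:emb (pcompose r \<xi>):] +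
     iota \<eta> * iota (pcompose (map_poly (\<lambda>r. pcompose r \<xi>) p) \<eta>)"
    unfolding iota_split using pCons.IH Y is_aut_emb[OF A X]
    by (simp only: is_autD[OF A] gens_in_M emb_in_M iota_in_M M_closed)
  then show ?case by (simp add: map_poly_pCons pcompose_pCons iota_hom iota_const)
qed

subsection \<open>Every automorphism preserves the projection to the line\<close>

text \<open>
  The derivation \<open>c \<partial>/\<partial>y\<close>. The factor \<open>c\<close> is what makes it map \<open>z\<close> into the ring: \<open>z\<close> goes to the
  \<open>y\<close>-derivative of \<open>q\<close>.
\<close>

definition vertical_der :: "'k fls poly \<Rightarrow> 'k fls poly" where
  "vertical_der f = cc * pderiv f"

lemma vertical_der_gens: "vertical_der (scal a) = 0" "vertical_der xx = 0" "vertical_der yy = cc"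
  by (simp_all add: vertical_der_def scal_def xx_def yy_def pderiv_pCons one_pCons)

lemma is_der_vertical_der: "is_der vertical_der"
proof -
  have add: "vertical_der (f + g) = vertical_der f + vertical_der g" for f g
    by (simp add: vertical_der_def pderiv_add algebra_simps)
  have mult: "vertical_der (f * g) = vertical_der f * g + f * vertical_der g" for f g
    by (simp add: vertical_der_def pderiv_mult algebra_simps)
  have nat: "emb (of_nat k) = of_nat k" for k
    by (induction k) (simp_all add: emb_hom(1,2,4))
  have "pderiv (iota p) = iota (pderiv p)" for p
    by (rule poly_eqI) (simp only: coeff_pderiv coeff_iota emb_hom(3) nat)
  then have "vertical_der zz = iota (pderiv q)"
    by (simp add: vertical_der_def zz_def cc_def pderiv_smult)
  then have Z: "vertical_der zz \<in> M" by (simp add: iota_in_M)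
  have "vertical_der f \<in> M" if "f \<in> M" for f
    by (rule M_induct[OF that, where Q = "\<lambda>f. vertical_der f \<in> M"])
      (simp_all add: vertical_der_gens Z add mult M_closed)
  then show ?thesis by (simp add: is_der_def add mult vertical_der_gens)
qed

lemma vertical_der_nilpotent: "(vertical_der ^^ Suc (degree f)) f = 0"
proof -
  have z: "(vertical_der ^^ m) 0 = 0" for m
    by (induction m) (simp_all add: vertical_der_def)
  have deg0: "pderiv f = 0" if "degree f = 0" for f :: "'k fls poly"
    using that by (auto simp: pderiv_pCons elim!: degree_eq_zeroE)
  have "(vertical_der ^^ Suc m) f = 0" if "degree f \<le> m" for m f
    using that
  proof (induction m arbitrary: f)
    case 0
    then show ?case using deg0 by (simp add: vertical_der_def)
  next
    case (Suc m)
    have "degree (vertical_der f) \<le> m"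
      using Suc.prems degree_mult_le[of cc "pderiv f"] by (simp add: vertical_der_def degree_pderiv cc_def)
    from Suc.IH[OF this] show ?case by (simp only: funpow_Suc_right o_def)
  qed
  then show ?thesis by blast
qed

definition conjugate_der where "conjugate_der s s' f = s (vertical_der (s' f))"

lemma is_der_conjugate_der:
  assumes A: "is_aut s s'"
  shows "is_der (conjugate_der s s')"
  unfolding is_der_def conjugate_der_def
  by (auto simp: is_autD[OF A] is_autD[OF is_aut_sym[OF A]] is_derD[OF is_der_vertical_der] M_closed
      is_aut_0[OF A])

lemma conjugate_der_image: "is_aut s s' \<Longrightarrow> f \<in> M \<Longrightarrow> conjugate_der s s' (s f) = s (vertical_der f)"
  by (simp add: conjugate_der_def is_autD)

lemma conjugate_der_nilpotent:
  assumes A: "is_aut s s'" and f: "f \<in> M"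
  shows "\<exists>m. (conjugate_der s s' ^^ m) f = 0"
proof -
  have in_M: "(vertical_der ^^ m) g \<in> M" if "g \<in> M" for m g
    using that by (induction m) (simp_all add: is_derD[OF is_der_vertical_der])
  have "(conjugate_der s s' ^^ m) f = s ((vertical_der ^^ m) (s' f))" for m
    by (induction m) (simp_all add: conjugate_der_def is_autD[OF A] f in_M)
  then show ?thesis
    using vertical_der_nilpotent[of "s' f"] by (metis is_aut_0[OF A])
qed

text \<open>
  The heart of the argument: a nonzero locally nilpotent derivation kills no element that involves \<open>y\<close>. Its action on
  leading monomials is monomial, local nilpotency makes the weights of \<open>x\<close>, \<open>y\<close>, \<open>z\<close> natural
  multiples of a scalar \<open>g\<close>, and characteristic zero turns the relations between them into integer
  equations that \<open>cone_arithmetic\<close> refutes.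
\<close>

lemma nilpotent_kernel_degree:
  assumes D: "is_der D" and nil: "\<And>f. f \<in> M \<Longrightarrow> \<exists>m. (D ^^ m) f = 0"
    and nz: "D g \<noteq> 0" "g \<in> M" and h: "h \<in> M" "D h = 0"
  shows "degree h = 0"
proof (rule ccontr)
  assume dX: "degree h \<noteq> 0"
  define U where "U = smult fls_X (D xx)"
  define v where "v = D yy"
  have DE: "D f = xy_der U v f" if "f \<in> M" for f
    unfolding U_def v_def by (rule is_der_eq_xy_der[OF D that])
  have Dn: "(D ^^ m) f = (xy_der U v ^^ m) f \<and> (D ^^ m) f \<in> M" if "f \<in> M" for m f
    using that by (induction m) (auto simp: DE[symmetric] is_derD[OF D])
  have nil': "\<exists>m. (xy_der U v ^^ m) f = 0" if "f \<in> M" for f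
    using nil[OF that] Dn[OF that] by metis
  have U0: "U \<noteq> 0"
  proof
    assume U: "U = 0"
    then have "pderiv h * v = 0" using h DE by (simp add: xy_der_def)
    moreover have "pderiv h \<noteq> 0" using dX by (simp add: pderiv_eq_0_iff)
    ultimately have "v = 0" by simp
    then show False using nz DE U by (simp add: xy_der_def)
  qed
  obtain p r \<alpha> \<beta> where U: "leads U p r \<alpha>" and v: "leads v p (Suc r) \<beta>" and ab: "\<alpha> \<noteq> 0 \<or> \<beta> \<noteq> 0"
    using xy_der_leads_exists[OF U0] by blast
  (* each application of D lowers the weight by g *)
  define g where "g = - (of_int p * \<alpha> + of_nat r * \<beta>)"
  have "leads xx 1 0 1" by (simp add: leads_def xx_def)
  then obtain s1 where s1: "\<alpha> = of_nat s1 * g"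
    using nilpotent_weight_eq[OF _ _ U v] nil'[OF gens_in_M(2)] unfolding g_def
    by (metis add.right_neutral mult_1 mult_zero_left of_int_1 of_nat_0 zero_neq_one)
  have "leads yy 0 1 1" by (simp add: leads_def yy_def)
  then obtain s2 where s2: "\<beta> = of_nat s2 * g"
    using nilpotent_weight_eq[OF _ _ U v] nil'[OF gens_in_M(3)] unfolding g_def
    by (metis add.left_neutral mult_1 mult_zero_left of_int_0 of_nat_1 zero_neq_one)
  have "zz \<noteq> 0" using zz_top d2 by auto
  moreover have "fls_subdegree (lead_coeff zz) = int n"
    using l_nz by (simp add: zz_top subdegree_emb deg_c fls_inverse_subdegree)
  ultimately obtain b where "b \<noteq> 0" "leads zz (- int n) d b"
    using leads_exists[of zz] zz_top by auto
  then obtain s3 where s3: "of_int (- int n) * \<alpha> + of_nat d * \<beta> = of_nat s3 * g"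
    using nilpotent_weight_eq[OF _ _ U v] nil'[OF gens_in_M(4)] unfolding g_def by metis
  have g0: "g \<noteq> 0" using ab s1 s2 by auto
  have "(of_int (- int n * int s1 + int d * int s2) - of_nat s3) * g = 0"
    using s3 by (simp add: s1 s2 algebra_simps)
  then have "of_int (- int n * int s1 + int d * int s2) = (of_int (int s3) :: 'k)" using g0 by simp
  then have z: "- int n * int s1 + int d * int s2 = int s3" by (simp only: of_int_eq_iff)
  have "(of_int (int s1 * p + int s2 * int r) + 1) * g = of_int p * \<alpha> + of_nat r * \<beta> + g"
    by (simp add: s1 s2 algebra_simps)
  also have "\<dots> = 0" by (simp add: g_def)
  finally have "of_int (int s1 * p + int s2 * int r + 1) = (of_int 0 :: 'k)" using g0 by simp
  then have e: "int s1 * p + int s2 * int r = - 1" unfolding of_int_eq_iff by linarith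
  define i0 where "i0 = - fls_subdegree (lead_coeff h)"
  obtain a where a: "a \<noteq> 0" "leads h i0 (degree h) a"
    using leads_exists[of h] dX unfolding i0_def by fastforce
  have "leads 0 (i0 + p) (degree h + r) (a * (of_int i0 * \<alpha> + of_nat (degree h) * \<beta>))"
    using leads_xy_der[OF a(2) U v] h DE by simp
  then have "of_int i0 * \<alpha> + of_nat (degree h) * \<beta> = 0" using a(1) by (simp add: leads_0)
  then have "of_int (i0 * int s1 + int (degree h) * int s2) * g = 0"
    by (simp add: s1 s2 algebra_simps)
  then have "of_int (i0 * int s1 + int (degree h) * int s2) = (of_int 0 :: 'k)" using g0 by simp
  then have x: "i0 * int s1 + int (degree h) * int s2 = 0" unfolding of_int_eq_iff .
  have i0: "i0 \<ge> - int n * int (degree h div d)" by (rule M_cone[OF h(1) a(2,1)])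
  (* undo the division of D xx by x that is built into U *)
  have "leads [:fls_X_inv:] 1 0 (1::'k)" by (simp add: leads_def)
  from leads_mult[OF this U] have "leads (D xx) (p + 1) r \<alpha>"
    by (simp add: U_def fls_X_inv_times_conv_shift fls_X_times_conv_shift add.commute)
  then have u': "p + 1 \<ge> - int n * int (r div d)" if "s1 \<noteq> 0"
    using M_cone[OF is_derD(1)[OF D gens_in_M(2)]] s1 g0 that by simp
  have v': "p \<ge> - int n * int (Suc r div d)" if "s2 \<noteq> 0"
    using M_cone[OF is_derD(1)[OF D gens_in_M(3)] v[unfolded v_def]] s2 g0 that by simp
  show False
    by (rule cone_arithmetic[OF n2 d2 _ e z x i0 u' v']) (use dX in auto)
qed

lemma conjugate_der_nonzero:
  assumes "is_aut s s'"
  shows "conjugate_der s s' (s yy) \<noteq> 0"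
proof
  assume "conjugate_der s s' (s yy) = 0"
  then have "s cc = 0" using assms by (simp add: conjugate_der_image vertical_der_gens)
  then have "s' (s cc) = 0" using is_aut_0[OF is_aut_sym[OF assms]] by simp
  then have "cc = 0" using is_autD(3)[OF assms, of cc] by simp
  then show False by (simp add: cc_def)
qed

lemma aut_x_const:
  assumes A: "is_aut s s'"
  obtains \<xi> where "s xx = [:emb \<xi>:]"
proof -
  have "conjugate_der s s' (s xx) = 0"
    by (simp add: conjugate_der_image[OF A] vertical_der_gens is_aut_0[OF A])
  then have "degree (s xx) = 0"
    using conjugate_der_nonzero[OF A]
    by (intro nilpotent_kernel_degree[OF is_der_conjugate_der[OF A] conjugate_der_nilpotent[OF A], where g = "s yy"])
      (auto simp: is_autD[OF A])
  then show thesis using M_degree_0[OF is_autD(1)[OF A gens_in_M(2)]] that by blast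
qed

text \<open>Composing with the polynomial describing the inverse automorphism gives \<open>x\<close>, so both have degree one.\<close>

lemma aut_x:
  assumes A: "is_aut s s'"
  obtains \<xi> where "s xx = [:emb \<xi>:]" "degree \<xi> = 1"
proof -
  obtain \<xi> where \<xi>: "s xx = [:emb \<xi>:]" using aut_x_const[OF A] .
  obtain \<xi>' where \<xi>': "s' xx = [:emb \<xi>':]" using aut_x_const[OF is_aut_sym[OF A]] .
  have "xx = s (s' xx)" by (simp add: is_autD[OF A])
  then have "emb [:0, 1:] = emb (pcompose \<xi>' \<xi>)"
    by (simp add: \<xi>' is_aut_emb[OF A \<xi>]) (simp add: xx_def)
  then have "pcompose \<xi>' \<xi> = [:0, 1:]" unfolding emb_inj by simp
  then have "degree \<xi>' * degree \<xi> = 1" using degree_pcompose[of \<xi>' \<xi>] by simp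
  then show thesis using that \<xi> by simp
qed

text \<open>
  The conjugate of \<open>c \<partial>/\<partial>y\<close> kills the nonconstant polynomial \<open>s(x)\<close>, hence \<open>x\<close>, so it is a multiple \<open>v \<partial>/\<partial>y\<close>. It maps
  \<open>s(y)\<close> to \<open>s(c)\<close>, which is free of \<open>y\<close>; hence so are \<open>v\<close> and the \<open>y\<close>-derivative of \<open>s(y)\<close>.
\<close>

lemma aut_y:
  assumes A: "is_aut s s'"
  obtains p m where "s yy = iota [:p, m:]"
proof -
  obtain \<xi> where X: "s xx = [:emb \<xi>:]" and dx: "degree \<xi> = 1" using aut_x[OF A] .
  define D where "D = conjugate_der s s'"
  define U where "U = smult fls_X (D xx)"
  define v where "v = D yy"
  have DE: "D f = xy_der U v f" if "f \<in> M" for f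
    unfolding U_def v_def D_def by (rule is_der_eq_xy_der[OF is_der_conjugate_der[OF A] that])
  have "D (s xx) = 0"
    by (simp add: D_def conjugate_der_image[OF A] vertical_der_gens is_aut_0[OF A])
  then have "[:euler (emb \<xi>):] * U = 0"
    by (simp add: DE is_autD[OF A]) (simp add: X xy_der_def map_poly_pCons pderiv_pCons)
  moreover have "euler (emb \<xi>) $$ (- 1) \<noteq> 0"
    using dx by (auto simp: euler_nth emb_nth) (metis leading_coeff_0_iff One_nat_def degree_0 zero_neq_one)
  then have "[:euler (emb \<xi>):] \<noteq> 0" by auto
  ultimately have U0: "U = 0" by simp
  have "D (s yy) = s cc"
    by (simp add: D_def conjugate_der_image[OF A] vertical_der_gens)
  also have "\<dots> = [:emb (pcompose c \<xi>):]"
    unfolding cc_def by (rule is_aut_emb[OF A X])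
  finally have e: "pderiv (s yy) * v = [:emb (pcompose c \<xi>):]"
    by (simp add: DE is_autD[OF A] U0 xy_der_def)
  have "pcompose c \<xi> \<noteq> 0" using dx by (simp add: pcompose_eq_0_iff)
  then have nz: "pderiv (s yy) \<noteq> 0" "v \<noteq> 0" using e by auto
  have "degree (pderiv (s yy)) + degree v = 0"
    unfolding degree_mult_eq[OF nz, symmetric] e by simp
  then have "degree (s yy) - 1 = 0" by (simp add: degree_pderiv)
  then have d1: "degree (s yy) \<le> 1" by simp
  then have "degree (s yy) < d" using d2 by simp
  then obtain r where r: "s yy = iota r" by (rule M_low_degree[OF is_autD(1)[OF A gens_in_M(3)]])
  then have "degree r \<le> 1" using d1 by (simp add: degree_iota)
  then have "r = [:coeff r 0, coeff r 1:]"
    by (intro poly_eqI) (auto simp: coeff_pCons coeff_eq_0 split: nat.splits)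
  then show thesis using r that by metis
qed

text \<open>Comparing with the inverse shows that the coefficient of \<open>y\<close> is a unit of \<open>\<k>[x]\<close>.\<close>

lemma aut_form:
  assumes A: "is_aut s s'"
  obtains \<xi> p \<mu> where "s xx = [:emb \<xi>:]" "degree \<xi> = 1" "s yy = iota [:p, [:\<mu>:]:]" "\<mu> \<noteq> 0"
proof -
  obtain \<xi> where X: "s xx = [:emb \<xi>:]" and dx: "degree \<xi> = 1" using aut_x[OF A] .
  obtain p m where Y: "s yy = iota [:p, m:]" using aut_y[OF A] .
  obtain p' m' where Y': "s' yy = iota [:p', m':]" using aut_y[OF is_aut_sym[OF A]] .
  have "iota [:0, 1:] = s (s' yy)"
    unfolding is_autD(4)[OF A gens_in_M(3)] by (simp add: iota_pCons yy_def emb_hom(1,4) iota_hom(1))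
  also have "\<dots> = iota (pcompose (map_poly (\<lambda>r. pcompose r \<xi>) [:p', m':]) [:p, m:])"
    unfolding Y' by (rule is_aut_iota[OF A X Y])
  finally have "[:0, 1:] = pcompose (map_poly (\<lambda>r. pcompose r \<xi>) [:p', m':]) [:p, m:]"
    unfolding iota_inj .
  from arg_cong[OF this, of "\<lambda>f. coeff f 1"] have "m * pcompose m' \<xi> = 1"
    by (simp add: map_poly_pCons pcompose_pCons mult.commute)
  then have "is_unit m" by (metis dvd_triv_left)
  then obtain \<mu> where "m = [:\<mu>:]" "\<mu> \<noteq> 0" using is_unit_polyE by (metis dvd_0_left_iff zero_neq_one is_unit_poly_iff)
  then show thesis using that X dx Y by blast
qed

subsection \<open>Automorphisms of a generic surface are shifts\<close>

text \<open>
  The relation \<open>s(c) s(z) = s(q)\<close> has \<open>y\<close>-degree \<open>d\<close>, so \<open>s(z) = r + g z\<close> with \<open>r\<close> of smaller \<open>y\<close>-degree.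
  Comparing coefficients of \<open>y\<^sup>d\<close>, of \<open>y\<^sup>d\<^sup>-\<^sup>1\<close> and, modulo \<open>c\<close>, of \<open>y\<^sup>j\<close> for \<open>j < d\<close> determines \<open>s\<close> up to the
  polynomial \<open>h\<close>. The congruences modulo \<open>c\<close> are equalities because the coefficients of \<open>q\<close> have degree
  less than \<open>n\<close>.
\<close>

lemma aut_is_shift:
  assumes A: "is_aut s s'"
    and nz: "coeff_xy q 0 0 \<noteq> 0" "coeff_xy q 0 1 \<noteq> 0" "coeff_xy q 1 0 \<noteq> 0"
  obtains h where "s xx = xx" "s yy = [:emb (c * h), 1:]"
proof -
  obtain \<xi> p \<mu> where X: "s xx = [:emb \<xi>:]" and dx: "degree \<xi> = 1"
    and Y: "s yy = iota [:p, [:\<mu>:]:]" and mu: "\<mu> \<noteq> 0" using aut_form[OF A] .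
  define q' where "q' = map_poly (\<lambda>r. pcompose r \<xi>) q"
  define Q where "Q = pcompose q' [:p, [:\<mu>:]:]"
  have cq': "coeff q' j = pcompose (coeff q j) \<xi>" for j
    by (simp add: q'_def coeff_map_poly)
  have dq': "degree q' \<le> d"
    by (intro degree_le) (simp add: cq' coeff_eq_0 deg_q)
  have Qd: "coeff Q d = [:\<mu> ^ d * l:]"
    unfolding Q_def coeff_pcompose_linear_top[OF dq'] by (simp add: cq' top_q poly_const_pow)
  have "degree Q \<le> degree q' * degree [:p, [:\<mu>:]:]"
    unfolding Q_def by (rule degree_pcompose_le)
  also have "\<dots> \<le> d" using dq' mu by simp
  finally have dQ: "degree Q = d"
    using Qd mu l_nz by (intro antisym le_degree) auto
  define c' where "c' = pcompose c \<xi>"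
  have "degree c' = n" using dx by (simp add: c'_def degree_pcompose deg_c)
  then have c'0: "c' \<noteq> 0" using n2 by auto
  have scc: "s cc = [:emb c':]" unfolding cc_def c'_def by (rule is_aut_emb[OF A X])
  have sQ: "[:emb c':] * s zz = iota Q"
    unfolding scc[symmetric] is_autD(6)[OF A gens_in_M(5,4), symmetric] cc_mult_zz
    unfolding Q_def q'_def by (rule is_aut_iota[OF A X Y])
  have "degree ([:emb c':] * s zz) = d" unfolding sQ degree_iota by (rule dQ)
  then have "degree (s zz) = d" using c'0 by simp
  then obtain r g where r: "degree r < d" and g: "s zz = iota r + [:emb g:] * zz"
    by (rule M_degree_d[OF is_autD(1)[OF A gens_in_M(4)]])
  have "iota ([:c:] * Q) = cc * ([:emb c':] * s zz)"
    by (simp only: sQ iota_hom(3) iota_const cc_def)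
  also have "\<dots> = [:emb c':] * (cc * iota r + [:emb g:] * (cc * zz))"
    by (simp only: g algebra_simps)
  also have "\<dots> = iota ([:c':] * ([:c:] * r + [:g:] * q))"
    unfolding cc_mult_zz by (simp only: iota_hom(2,3) iota_const cc_def)
  finally have rel: "[:c:] * Q = [:c':] * ([:c:] * r + [:g:] * q)" unfolding iota_inj .
  have "c * [:\<mu> ^ d * l:] = c' * (g * [:l:])"
    using arg_cong[OF rel, of "\<lambda>f. coeff f d"] r by (simp add: Qd top_q coeff_eq_0)
  then have "smult l (smult (\<mu> ^ d) c) = smult l (c' * g)"
    by (simp add: mult.commute)
  then have cg: "smult (\<mu> ^ d) c = c' * g" using l_nz by (simp only: smult_cancel)
  have g0: "g \<noteq> 0" using cg mu by auto
  have "degree (c' * g) = n" unfolding cg[symmetric] using mu by (simp add: deg_c)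
  then have "degree g = 0" using \<open>degree c' = n\<close> c'0 g0 by (simp add: degree_mult_eq)
  then obtain \<gamma> where ga: "g = [:\<gamma>:]" by (rule degree_eq_zeroE)
  then have ga0: "\<gamma> \<noteq> 0" using g0 by simp
  define \<kappa> where "\<kappa> = \<mu> ^ d / \<gamma>"
  have c': "c' = smult \<kappa> c"
  proof -
    have "smult \<gamma> c' = smult \<gamma> (smult \<kappa> c)" using cg ga0 by (simp add: ga \<kappa>_def mult.commute)
    then show ?thesis using ga0 by (simp only: smult_cancel)
  qed
  have "[:c:] * Q = [:c:] * ([:[:\<kappa>:]:] * ([:c:] * r + [:g:] * q))"
    unfolding rel c' by (simp add: algebra_simps)
  then have "Q = [:[:\<kappa>:]:] * ([:c:] * r + [:g:] * q)" by (simp only: mult_cancel_left) simp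
  then have Qj: "coeff Q j = c * smult \<kappa> (coeff r j) + smult (\<mu> ^ d) (coeff q j)" for j
    using ga0 by (simp add: ga \<kappa>_def smult_add_right)
  (* c(a x + b) is a scalar multiple of c, and c has no term of degree n - 1 *)
  obtain b a where ba: "\<xi> = [:b, a:]" and a0: "a \<noteq> 0"
  proof -
    have "\<xi> = [:coeff \<xi> 0, coeff \<xi> 1:]"
      using dx by (intro poly_eqI) (auto simp: coeff_pCons coeff_eq_0 split: nat.splits)
    moreover have "coeff \<xi> 1 \<noteq> 0" using dx by (metis leading_coeff_0_iff degree_0 zero_neq_one)
    ultimately show thesis using that by blast
  qed
  have "coeff c' (n - 1) = a ^ (n - 1) * (coeff c (n - 1) + of_nat (Suc (n - 1)) * b * coeff c (Suc (n - 1)))"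
    unfolding c'_def ba by (rule coeff_pcompose_linear_subtop) (use n2 in \<open>simp add: deg_c\<close>)
  then have "of_nat n * b * coeff c n = 0"
    using a0 n2 by (simp add: c' subtop_c[unfolded One_nat_def] del: of_nat_Suc)
  moreover have "coeff c n \<noteq> 0" using deg_c c_nz leading_coeff_0_iff by metis
  ultimately have b0: "b = 0" using n2 by simp
  (* q has no term in y^(d-1), so what the translation by p creates there is divisible by c *)
  have "coeff Q (d - 1) = [:\<mu>:] ^ (d - 1) * (coeff q' (d - 1) + of_nat (Suc (d - 1)) * p * coeff q' (Suc (d - 1)))"
    unfolding Q_def by (rule coeff_pcompose_linear_subtop) (use dq' in simp)
  then have "c * smult \<kappa> (coeff r (d - 1)) = [:\<mu>:] ^ (d - 1) * (of_nat d * p * [:l:])"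
    using d2 by (simp add: Qj subtop_q[unfolded One_nat_def] cq' top_q del: of_nat_Suc)
  also have "\<dots> = smult (\<mu> ^ (d - 1) * of_nat d * l) p"
    by (simp add: poly_const_pow of_nat_poly mult_ac)
  finally have "c dvd smult (\<mu> ^ (d - 1) * of_nat d * l) p" by (metis dvd_triv_left)
  then have "c dvd p" using mu l_nz d2 by (simp add: dvd_smult_iff)
  then obtain h where h: "p = c * h" by (rule dvdE)
  have weight: "\<mu> ^ d * coeff_xy q i j = \<mu> ^ j * a ^ i * coeff_xy q i j" if j: "j < d" for i j
  proof -
    have "p dvd coeff Q j - [:\<mu>:] ^ j * coeff q' j"
      unfolding Q_def by (rule dvd_coeff_pcompose_linear)
    then have "c dvd coeff Q j - [:\<mu>:] ^ j * coeff q' j" unfolding h by (rule dvd_mult_left)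
    then have "c dvd (c * smult \<kappa> (coeff r j)) + (smult (\<mu> ^ d) (coeff q j) - [:\<mu>:] ^ j * coeff q' j)"
      by (simp add: Qj add_diff_eq)
    then have dvd: "c dvd smult (\<mu> ^ d) (coeff q j) - [:\<mu>:] ^ j * coeff q' j"
      by (rule iffD1[OF dvd_add_right_iff[OF dvd_triv_left]])
    have "degree (coeff q' j) < n"
      using deg_coeff_q[OF j] dx by (simp add: cq' degree_pcompose)
    then have "degree (smult (\<mu> ^ d) (coeff q j) - [:\<mu>:] ^ j * coeff q' j) < n"
      using deg_coeff_q[OF j] by (intro degree_diff_less) (auto simp: poly_const_pow mu)
    then have "smult (\<mu> ^ d) (coeff q j) - [:\<mu>:] ^ j * coeff q' j = 0"
      using dvd dvd_imp_degree_le deg_c by (metis not_le)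
    from arg_cong[OF this, of "\<lambda>f. coeff f i"] show ?thesis
      by (simp add: poly_const_pow cq' ba b0 coeff_pcompose_linear coeff_xy_def)
  qed
  have "\<mu> ^ d = 1" using weight[of 0 0] nz d2 by simp
  moreover from this have "\<mu> = 1" using weight[of 1 0] nz d2 by simp
  ultimately have "a = 1" using weight[of 0 1] nz d2 by simp
  then have "s xx = xx" unfolding X ba b0 by (simp add: xx_def)
  moreover have "s yy = [:emb (c * h), 1:]"
    unfolding Y using \<open>\<mu> = 1\<close> by (simp add: iota_pCons h emb_hom)
  ultimately show thesis by (rule that)
qed

section \<open>Simple derivations commute with no shift\<close>

lemma is_aut_shift:
  assumes A: "is_aut s s'" and X: "s xx = xx" and Y: "s yy = [:e, 1:]" and f: "f \<in> M"
  shows "s f = pcompose f [:e, 1:]"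
proof -
  define S where "S f = pcompose f [:e, 1:]" for f :: "'k fls poly"
  have S: "S (f + g) = S f + S g" "S (f * g) = S f * S g" for f g
    by (simp_all add: S_def pcompose_add pcompose_mult)
  have gen: "S (scal a) = scal a" "S xx = xx" "S yy = [:e, 1:]" "S cc = cc" for a
    by (simp_all add: S_def scal_def xx_def yy_def cc_def pcompose_pCons)
  have i: "s (iota p) = S (iota p)" for p
    by (rule iota_induct[where Q = "\<lambda>f. s f = S f"]) (simp_all add: is_autD[OF A] S gen X Y)
  have "s cc = cc" using i[of "[:c:]"] gen by (simp add: iota_const cc_def)
  then have "cc * s zz = cc * S zz"
    using i[of q] unfolding cc_mult_zz[symmetric] by (simp add: is_autD[OF A] S gen)
  moreover have "cc \<noteq> 0" by (simp add: cc_def)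
  ultimately have Z: "s zz = S zz" by simp
  have "s f = S f"
    by (rule M_induct[OF f, where Q = "\<lambda>f. s f = S f"]) (simp_all add: is_autD[OF A] S gen X Y Z)
  then show ?thesis by (simp add: S_def)
qed

lemma der_emb:
  assumes D: "is_der D"
  shows "D [:emb r:] = [:emb (pderiv r):] * D xx"
proof (induction r)
  case 0
  then show ?case using is_derD(4)[OF D, of 0] by (simp add: scal_0 emb_hom)
next
  case (pCons a r)
  have "D [:emb (pCons a r):] = 0 + (D xx * [:emb r:] + xx * ([:emb (pderiv r):] * D xx))"
    unfolding emb_split using pCons.IH
    by (simp only: is_derD[OF D] gens_in_M emb_in_M M_closed)
  also have "\<dots> = ([:emb r:] + xx * [:emb (pderiv r):]) * D xx"
    by (simp only: algebra_simps add_0_left)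
  also have "[:emb r:] + xx * [:emb (pderiv r):] = [:emb (pderiv (pCons a r)):]"
    by (simp add: pderiv_pCons emb_hom(2) emb_pCons xx_def)
  finally show ?case .
qed

definition is_ideal :: "'k fls poly set \<Rightarrow> bool" where
  "is_ideal J \<longleftrightarrow> J \<subseteq> M \<and> J \<noteq> {} \<and> (\<forall>f\<in>J. \<forall>g\<in>J. f + g \<in> J) \<and> (\<forall>f\<in>J. \<forall>g\<in>M. g * f \<in> J)"

definition is_simple :: "('k fls poly \<Rightarrow> 'k fls poly) \<Rightarrow> bool" where
  "is_simple D \<longleftrightarrow> (\<forall>J. is_ideal J \<and> D ` J \<subseteq> J \<longrightarrow> J = {0} \<or> J = M)"

text \<open>
  The ideal generated by a polynomial \<open>t(x)\<close> dividing its own derivative under \<open>D\<close> is stable. It is not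
  zero, so \<open>t\<close> is invertible in the ring; an inverse has \<open>y\<close>-degree zero, hence lies in \<open>\<k>[x]\<close>.
\<close>

lemma simple_stable_poly_const:
  assumes D: "is_der D" and simple: "is_simple D"
    and t: "t \<noteq> 0" and k: "k \<in> M" and Dt: "D [:emb t:] = k * [:emb t:]"
  shows "degree t = 0"
proof -
  define J where "J = (\<lambda>f. [:emb t:] * f) ` M"
  have "is_ideal J"
    unfolding is_ideal_def
  proof (intro conjI ballI)
    show "J \<subseteq> M" by (auto simp: J_def intro!: M_closed emb_in_M simp del: mult_pCons_left)
    show "J \<noteq> {}" using M_closed(4) by (auto simp: J_def)
  next
    fix f g assume "f \<in> J" "g \<in> J"
    then obtain f' g' where "f = [:emb t:] * f'" "g = [:emb t:] * g'" "f' \<in> M" "g' \<in> M"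
      by (auto simp: J_def)
    then have "f + g = [:emb t:] * (f' + g')" "f' + g' \<in> M" by (simp_all only: M_closed distrib_left)
    then show "f + g \<in> J" unfolding J_def by blast
  next
    fix f g assume "f \<in> J" "g \<in> M"
    then obtain f' where "f = [:emb t:] * f'" "f' \<in> M" by (auto simp: J_def)
    then have "g * f = [:emb t:] * (g * f')" "g * f' \<in> M"
      using \<open>g \<in> M\<close> by (simp_all only: M_closed mult.left_commute)
    then show "g * f \<in> J" unfolding J_def by blast
  qed
  moreover have "D ` J \<subseteq> J"
  proof
    fix y assume "y \<in> D ` J"
    then obtain f where f: "f \<in> M" "y = D ([:emb t:] * f)" by (auto simp: J_def)
    have "y = [:emb t:] * (k * f + D f)"
      unfolding f(2) is_derD(3)[OF D emb_in_M f(1)] Dt by (simp only: algebra_simps)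
    moreover have "k * f + D f \<in> M" using f(1) k by (intro M_closed is_derD(1)[OF D])
    ultimately show "y \<in> J" unfolding J_def by blast
  qed
  ultimately have "J = {0} \<or> J = M" using simple by (simp add: is_simple_def)
  moreover have "[:emb t:] * 1 \<in> J" unfolding J_def using M_closed(5) by blast
  then have "J \<noteq> {0}" using t by auto
  ultimately have "1 \<in> J" using M_closed(5) by simp
  then obtain f where f: "f \<in> M" "1 = [:emb t:] * f" by (auto simp: J_def)
  then have "f \<noteq> 0" by auto
  then have "degree f = 0"
    using arg_cong[OF f(2), of degree] t by simp
  then obtain g where "f = [:emb g:]" using M_degree_0[OF f(1)] by blast
  then have "iota (1::'k poly poly) = iota [:t * g:]" using f(2) by (simp add: iota_hom(1) iota_const emb_hom(3) mult.commute)
  then have "t * g = 1" unfolding iota_inj by (simp add: one_pCons)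
  then show ?thesis by (metis is_unit_iff_degree t dvd_triv_left)
qed

text \<open>
  A shift by \<open>e\<close> changes the second highest coefficient of \<open>f\<close> by \<open>degree f\<close> times \<open>e\<close> times the
  leading one; for degree at least two that coefficient lies above the constant term.
\<close>

lemma shift_invariant_degree:
  fixes f :: "'k fls poly"
  assumes e: "e \<noteq> 0" and f: "pcompose f [:e, 1:] = f + [:w:]"
  shows "degree f \<le> 1" and "w = 0 \<Longrightarrow> degree f = 0"
proof -
  have *: "coeff [:w:] N \<noteq> 0" if N: "degree f = Suc N" for N
  proof
    assume w: "coeff [:w:] N = 0"
    have "coeff (pcompose f [:e, 1:]) N = 1 ^ N * (coeff f N + of_nat (Suc N) * e * coeff f (Suc N))"
      using N by (intro coeff_pcompose_linear_subtop) simp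
    then have "of_nat (Suc N) * e * coeff f (Suc N) = 0"
      unfolding f coeff_add w by simp
    then have "coeff f (Suc N) = 0" using e by (simp del: of_nat_Suc)
    moreover have "f \<noteq> 0" using N by auto
    ultimately show False using N leading_coeff_0_iff by metis
  qed
  show "degree f \<le> 1"
  proof (rule ccontr)
    assume "\<not> degree f \<le> 1"
    then obtain N where "degree f = Suc (Suc N)" by (metis One_nat_def le_SucI le0 not0_implies_Suc order_refl)
    from *[OF this] show False by simp
  qed
  show "degree f = 0" if "w = 0"
    using * that by (cases "degree f") auto
qed

lemma model_isotropy_trivial:
  assumes A: "is_aut s s'" and D: "is_der D" and simple: "is_simple D"
    and comm: "\<And>f. f \<in> M \<Longrightarrow> s (D f) = D (s f)"
    and nz: "coeff_xy q 0 0 \<noteq> 0" "coeff_xy q 0 1 \<noteq> 0" "coeff_xy q 1 0 \<noteq> 0"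
    and f: "f \<in> M"
  shows "s f = f"
proof -
  obtain h where X: "s xx = xx" and Y: "s yy = [:emb (c * h), 1:]" using aut_is_shift[OF A nz] .
  note shift = is_aut_shift[OF A X Y]
  (* D xx is a nonzero scalar w, and D yy = v1 y + v0 with v1 * (c h) = w * (c h)', against degrees *)
  have "h = 0"
  proof (rule ccontr)
    assume "h \<noteq> 0"
    then have e0: "emb (c * h) \<noteq> 0" by simp
    have "s (D xx) = D xx" using comm[of xx] X by simp
    then have "degree (D xx) = 0"
      by (intro shift_invariant_degree(2)[OF e0, of _ 0]) (simp_all add: shift is_derD[OF D])
    then obtain w where w: "D xx = [:emb w:]" using M_degree_0 is_derD(1)[OF D] by blast
    have w0: "w \<noteq> 0"
    proof
      assume "w = 0"
      then have "D [:emb [:0, 1:]:] = 0 * [:emb [:0, 1:]:]" using w by (simp add: xx_def emb_hom(4))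
      from simple_stable_poly_const[OF D simple _ _ this] show False by (simp add: M_closed)
    qed
    have "D [:emb w:] = [:emb (pderiv w):] * [:emb w:]" using der_emb[OF D] w by simp
    then have "degree w = 0" by (rule simple_stable_poly_const[OF D simple w0 emb_in_M])
    then obtain \<omega> where om: "w = [:\<omega>:]" by (rule degree_eq_zeroE)
    have "s yy = yy + [:emb (c * h):]" unfolding Y by (simp add: yy_def)
    then have "s (D yy) = D yy + D [:emb (c * h):]"
      using comm[of yy] by (simp only: gens_in_M is_derD[OF D] emb_in_M)
    also have "D [:emb (c * h):] = [:emb (pderiv (c * h) * w):]"
      unfolding der_emb[OF D] w by (simp add: emb_hom(3))
    finally have sv: "pcompose (D yy) [:emb (c * h), 1:] = D yy + [:emb (pderiv (c * h) * w):]"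
      by (simp add: shift is_derD[OF D])
    then have "degree (D yy) \<le> 1" by (rule shift_invariant_degree(1)[OF e0])
    then have d1: "degree (D yy) < d" using d2 by simp
    obtain v where v: "D yy = iota v" by (rule M_low_degree[OF is_derD(1)[OF D gens_in_M(3)] d1])
    then have "degree v \<le> 1" using \<open>degree (D yy) \<le> 1\<close> by (simp add: degree_iota)
    then have "v = [:coeff v 0, coeff v 1:]"
      by (intro poly_eqI) (auto simp: coeff_pCons coeff_eq_0 split: nat.splits)
    then obtain v0 v1 where v01: "v = [:v0, v1:]" by blast
    have "emb (c * h * v1) = emb (pderiv (c * h) * w)"
      using arg_cong[OF sv, of "\<lambda>f. coeff f 0"]
      by (simp add: v v01 iota_pCons pcompose_pCons emb_hom(3) mult.commute mult.left_commute)
    then have eq: "c * h * v1 = smult \<omega> (pderiv (c * h))" unfolding emb_inj by (simp add: om)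
    have "degree (c * h) \<ge> n" using \<open>h \<noteq> 0\<close> by (simp add: degree_mult_eq deg_c)
    then have dch: "degree (c * h) > 0" using n2 by simp
    then have "pderiv (c * h) \<noteq> 0" by (simp add: pderiv_eq_0_iff)
    then have "v1 \<noteq> 0" using eq w0 om by auto
    then have "degree (c * h) \<le> degree (c * h * v1)" using \<open>h \<noteq> 0\<close> by (simp add: degree_mult_eq)
    also have "\<dots> \<le> degree (c * h) - 1" unfolding eq by (simp add: degree_pderiv degree_smult_eq)
    finally show False using dch by simp
  qed
  then show ?thesis using shift[OF f] by (simp add: emb_hom(4))
qed

section \<open>Transfer to the quotient ring\<close>

text \<open>
  The class of \<open>P\<close> in the quotient ring is the fibre of \<open>phi\<close> over \<open>phi P\<close>, because the kernel of \<open>phi\<close> is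
  the ideal of the surface. So \<open>fibre\<close> is the ring isomorphism from \<open>M\<close> onto the quotient, and
  \<open>fibre_value\<close> is its inverse.
\<close>

definition fibre :: "'k fls poly \<Rightarrow> 'k poly poly poly set" where
  "fibre f = {P. phi P = f}"

definition fibre_value :: "'k poly poly poly set \<Rightarrow> 'k fls poly" where
  "fibre_value K = phi (SOME P. P \<in> K)"

lemma fibre_value_fibre: "f \<in> M \<Longrightarrow> fibre_value (fibre f) = f"
  using someI_ex[of "\<lambda>P. phi P = f"] by (auto simp: fibre_value_def fibre_def M_def)

lemma fibre_inj: "f \<in> M \<Longrightarrow> g \<in> M \<Longrightarrow> fibre f = fibre g \<longleftrightarrow> f = g"
  using fibre_value_fibre by metis

lemma coset_eq_fibre: "surface_ideal c q +>\<^bsub>ring_of_type_algebra\<^esub> P = fibre (phi P)"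
proof -
  have "phi Q = phi P \<longleftrightarrow> (\<exists>x. Q = x * surface_relation c q + P)" for Q
  proof -
    have "phi Q = phi P \<longleftrightarrow> phi (Q - P) = 0" by (simp add: phi_hom(6))
    also have "\<dots> \<longleftrightarrow> (\<exists>x. Q = x * surface_relation c q + P)"
      unfolding phi_eq_0_iff dvd_def by (auto simp: algebra_simps)
    finally show ?thesis .
  qed
  then show ?thesis
    by (auto simp: fibre_def surface_ideal_def cgenideal_def a_r_coset_def' ring_of_type_algebra_def)
qed

lemma ideal_surface_ideal: "ideal (surface_ideal c q) ring_of_type_algebra"
  unfolding surface_ideal_def
  by (rule cring.cgenideal_ideal[OF cring_from_type_algebra]) (simp add: ring_of_type_algebra_def)

lemma cring_surface_ring: "cring (surface_ring c q)"
  unfolding surface_ring_def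
  by (rule ideal.quotient_is_cring[OF ideal_surface_ideal cring_from_type_algebra])

lemma carrier_surface_ring: "carrier (surface_ring c q) = fibre ` M"
  unfolding surface_ring_def FactRing_def A_RCOSETS_def'
  by (auto simp: coset_eq_fibre M_def ring_of_type_algebra_def)
     (use coset_eq_fibre in \<open>auto simp: ring_of_type_algebra_def\<close>)

lemma coset_ring_hom:
  "(\<lambda>P. fibre (phi P)) \<in> ring_hom ring_of_type_algebra (surface_ring c q)"
  using ideal.rcos_ring_hom[OF ideal_surface_ideal]
  unfolding surface_ring_def coset_eq_fibre[symmetric] .

lemma surface_ring_ops:
  assumes "f \<in> M" "g \<in> M"
  shows "fibre f \<oplus>\<^bsub>surface_ring c q\<^esub> fibre g = fibre (f + g)"
    "fibre f \<otimes>\<^bsub>surface_ring c q\<^esub> fibre g = fibre (f * g)"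
proof -
  obtain P Q where PQ: "f = phi P" "g = phi Q" using assms by (auto simp: M_def)
  show "fibre f \<oplus>\<^bsub>surface_ring c q\<^esub> fibre g = fibre (f + g)"
    "fibre f \<otimes>\<^bsub>surface_ring c q\<^esub> fibre g = fibre (f * g)"
    using ring_hom_add[OF coset_ring_hom, of P Q] ring_hom_mult[OF coset_ring_hom, of P Q]
    by (simp_all add: PQ ring_of_type_algebra_def phi_hom)
qed

lemma surface_ring_zero: "\<zero>\<^bsub>surface_ring c q\<^esub> = fibre 0"
  by (auto simp: surface_ring_def FactRing_def fibre_def surface_ideal_def cgenideal_def
      ring_of_type_algebra_def phi_eq_0_iff dvd_def mult.commute)

lemma surface_const_eq: "surface_const c q a = fibre (scal a)"
  unfolding surface_const_def coset_eq_fibre gens ..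

lemma fibre_ideal:
  assumes J: "is_ideal J"
  shows "ideal (fibre ` J) (surface_ring c q)"
proof -
  interpret A: cring "surface_ring c q" by (rule cring_surface_ring)
  have JM: "J \<subseteq> M" and ne: "J \<noteq> {}" and add: "\<And>f g. f \<in> J \<Longrightarrow> g \<in> J \<Longrightarrow> f + g \<in> J"
    and mult: "\<And>f g. f \<in> J \<Longrightarrow> g \<in> M \<Longrightarrow> g * f \<in> J"
    using J by (auto simp: is_ideal_def)
  have zero: "0 \<in> J" using ne mult[of _ 0] M_closed(4) by auto
  have neg: "- f \<in> J" if "f \<in> J" for f
    using mult[OF that gens_in_M(1), of "- 1"] by (simp add: scal_def)
  have minus: "\<ominus>\<^bsub>surface_ring c q\<^esub> fibre f = fibre (- f)" if "f \<in> J" for f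
  proof (rule A.minus_equality)
    show "fibre (- f) \<oplus>\<^bsub>surface_ring c q\<^esub> fibre f = \<zero>\<^bsub>surface_ring c q\<^esub>"
      using that neg[OF that] JM by (subst surface_ring_ops) (auto simp: surface_ring_zero)
  qed (use that neg[OF that] JM in \<open>auto simp: carrier_surface_ring\<close>)
  show ?thesis
  proof (rule idealI)
    show "ring (surface_ring c q)" by (rule A.ring_axioms)
    show "subgroup (fibre ` J) (add_monoid (surface_ring c q))"
    proof (rule subgroup.intro)
      show "fibre ` J \<subseteq> carrier (add_monoid (surface_ring c q))"
        using JM by (auto simp: carrier_surface_ring)
      show "\<one>\<^bsub>add_monoid (surface_ring c q)\<^esub> \<in> fibre ` J"
        using zero by (simp add: surface_ring_zero)
    next
      fix x y assume "x \<in> fibre ` J" "y \<in> fibre ` J"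
      then show "x \<otimes>\<^bsub>add_monoid (surface_ring c q)\<^esub> y \<in> fibre ` J"
        using JM add by (auto simp: surface_ring_ops subset_iff)
    next
      fix x assume "x \<in> fibre ` J"
      then show "inv\<^bsub>add_monoid (surface_ring c q)\<^esub> x \<in> fibre ` J"
        unfolding a_inv_def[symmetric] using minus neg by auto
    qed
  next
    fix a x assume "a \<in> fibre ` J" "x \<in> carrier (surface_ring c q)"
    then show "x \<otimes>\<^bsub>surface_ring c q\<^esub> a \<in> fibre ` J" "a \<otimes>\<^bsub>surface_ring c q\<^esub> x \<in> fibre ` J"
      using JM mult by (auto simp: carrier_surface_ring surface_ring_ops subset_iff mult.commute)
  qed
qed

text \<open>The map of \<open>M\<close> corresponding to a map \<open>F\<close> of the quotient ring.\<close>

definition on_model :: "('k poly poly poly set \<Rightarrow> 'k poly poly poly set) \<Rightarrow> 'k fls poly \<Rightarrow> 'k fls poly" where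
  "on_model F f = fibre_value (F (fibre f))"

lemma on_model:
  assumes "F \<in> carrier (surface_ring c q) \<rightarrow> carrier (surface_ring c q)" "f \<in> M"
  shows "on_model F f \<in> M" "F (fibre f) = fibre (on_model F f)"
proof -
  obtain g where "g \<in> M" "F (fibre f) = fibre g"
    using assms by (auto simp: carrier_surface_ring Pi_iff)
  then show "on_model F f \<in> M" "F (fibre f) = fibre (on_model F f)" by (simp_all add: on_model_def fibre_value_fibre)
qed

lemma on_model_eqI: "F (fibre f) = fibre g \<Longrightarrow> g \<in> M \<Longrightarrow> on_model F f = g"
  by (simp add: on_model_def fibre_value_fibre)

text \<open>Linearity over \<open>\<k>\<close> gives the vanishing on scalars, as the derivative of \<open>1\<close> is zero by the Leibniz rule.\<close>

lemma is_der_on_model: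
  assumes "D \<in> derivations (surface_ring c q) (surface_const c q)"
  shows "is_der (on_model D)"
proof -
  let ?A = "surface_ring c q"
  have Pi: "D \<in> carrier ?A \<rightarrow> carrier ?A"
    and D_add: "\<And>f g. f \<in> carrier ?A \<Longrightarrow> g \<in> carrier ?A \<Longrightarrow> D (f \<oplus>\<^bsub>?A\<^esub> g) = D f \<oplus>\<^bsub>?A\<^esub> D g"
    and D_lin: "\<And>a f. f \<in> carrier ?A \<Longrightarrow>
      D (fibre (scal a) \<otimes>\<^bsub>?A\<^esub> f) = fibre (scal a) \<otimes>\<^bsub>?A\<^esub> D f"
    and D_mult: "\<And>f g. f \<in> carrier ?A \<Longrightarrow> g \<in> carrier ?A \<Longrightarrow>
      D (f \<otimes>\<^bsub>?A\<^esub> g) = (D f \<otimes>\<^bsub>?A\<^esub> g) \<oplus>\<^bsub>?A\<^esub> (f \<otimes>\<^bsub>?A\<^esub> D g)"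
    using assms by (simp_all add: derivations_def surface_const_eq PiE_iff Pi_iff)
  note p = on_model[OF Pi]
  have car: "fibre f \<in> carrier (surface_ring c q)" if "f \<in> M" for f
    using that by (simp add: carrier_surface_ring)
  have add: "on_model D (f + g) = on_model D f + on_model D g" if "f \<in> M" "g \<in> M" for f g
  proof (rule on_model_eqI)
    have "D (fibre f \<oplus>\<^bsub>?A\<^esub> fibre g) = D (fibre f) \<oplus>\<^bsub>?A\<^esub> D (fibre g)"
      by (rule D_add[OF car[OF that(1)] car[OF that(2)]])
    then show "D (fibre (f + g)) = fibre (on_model D f + on_model D g)"
      using that by (simp add: p surface_ring_ops)
  qed (use that p M_closed in auto)
  have mult: "on_model D (f * g) = on_model D f * g + f * on_model D g" if "f \<in> M" "g \<in> M" for f g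
  proof (rule on_model_eqI)
    have "D (fibre f \<otimes>\<^bsub>surface_ring c q\<^esub> fibre g) =
        (D (fibre f) \<otimes>\<^bsub>surface_ring c q\<^esub> fibre g) \<oplus>\<^bsub>surface_ring c q\<^esub> (fibre f \<otimes>\<^bsub>surface_ring c q\<^esub> D (fibre g))"
      by (rule D_mult[OF car[OF that(1)] car[OF that(2)]])
    then show "D (fibre (f * g)) = fibre (on_model D f * g + f * on_model D g)"
      using that by (simp add: p surface_ring_ops M_closed)
  qed (use that p M_closed in auto)
  have lin: "on_model D (scal a * f) = scal a * on_model D f" if "f \<in> M" for f a
  proof (rule on_model_eqI)
    have "D (fibre (scal a) \<otimes>\<^bsub>surface_ring c q\<^esub> fibre f) = fibre (scal a) \<otimes>\<^bsub>surface_ring c q\<^esub> D (fibre f)"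
      by (rule D_lin[OF car[OF that]])
    then show "D (fibre (scal a * f)) = fibre (scal a * on_model D f)"
      using that by (simp add: p surface_ring_ops)
  qed (use that p M_closed in auto)
  have "on_model D 1 = 0" using mult[of 1 1] M_closed(5) by simp
  then have "on_model D (scal a) = 0" for a using lin[of 1 a] M_closed(5) by simp
  then show ?thesis unfolding is_der_def using p(1) add mult by simp
qed

lemma is_simple_on_model:
  assumes D: "D \<in> carrier (surface_ring c q) \<rightarrow> carrier (surface_ring c q)"
    and simple: "simple_derivation (surface_ring c q) D"
  shows "is_simple (on_model D)"
  unfolding is_simple_def
proof (intro allI impI)
  fix J assume J: "is_ideal J \<and> on_model D ` J \<subseteq> J"
  then have JM: "J \<subseteq> M" by (simp add: is_ideal_def)
  have "D ` fibre ` J \<subseteq> fibre ` J"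
  proof (clarsimp simp: image_image)
    fix f assume f: "f \<in> J"
    then have "D (fibre f) = fibre (on_model D f)" using JM by (intro on_model(2)[OF D]) blast
    moreover have "on_model D f \<in> J" using J f by blast
    ultimately show "D (fibre f) \<in> fibre ` J" by simp
  qed
  moreover have "ideal (fibre ` J) (surface_ring c q)" using J by (intro fibre_ideal) simp
  ultimately have "fibre ` J = {fibre 0} \<or> fibre ` J = fibre ` M"
    using simple by (simp add: simple_derivation_def carrier_surface_ring surface_ring_zero)
  moreover have "inj_on fibre M" using fibre_inj by (auto simp: inj_on_def)
  ultimately show "J = {0} \<or> J = M"
    using JM M_closed(4) inj_on_image_eq_iff[of fibre M J M] inj_on_image_eq_iff[of fibre M J "{0}"] by simp
qed

lemma is_aut_on_model:
  assumes "\<sigma> \<in> algebra_auts (surface_ring c q) (surface_const c q)"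
  shows "is_aut (on_model \<sigma>) (on_model (inv_into (carrier (surface_ring c q)) \<sigma>))"
proof -
  define \<tau> where "\<tau> = inv_into (carrier (surface_ring c q)) \<sigma>"
  have hom: "\<sigma> \<in> ring_hom (surface_ring c q) (surface_ring c q)"
    and bij: "bij_betw \<sigma> (carrier (surface_ring c q)) (carrier (surface_ring c q))"
    and const: "\<And>a. \<sigma> (fibre (scal a)) = fibre (scal a)"
    using assms by (auto simp: algebra_auts_def ring_iso_def surface_const_eq)
  have Pi: "\<sigma> \<in> carrier (surface_ring c q) \<rightarrow> carrier (surface_ring c q)"
    using bij by (auto simp: bij_betw_def)
  have "bij_betw \<tau> (carrier (surface_ring c q)) (carrier (surface_ring c q))"
    unfolding \<tau>_def by (rule bij_betw_inv_into[OF bij])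
  then have Pi': "\<tau> \<in> carrier (surface_ring c q) \<rightarrow> carrier (surface_ring c q)"
    by (auto simp: bij_betw_def)
  note p = on_model[OF Pi] and p' = on_model[OF Pi']
  have car: "fibre f \<in> carrier (surface_ring c q)" if "f \<in> M" for f
    using that by (simp add: carrier_surface_ring)
  have 1: "on_model \<tau> (on_model \<sigma> f) = f" if "f \<in> M" for f
    using that bij_betw_inv_into_left[OF bij car[OF that]]
    by (intro on_model_eqI) (simp_all add: \<tau>_def p(2)[symmetric])
  have 2: "on_model \<sigma> (on_model \<tau> f) = f" if "f \<in> M" for f
    using that bij_betw_inv_into_right[OF bij car[OF that]]
    by (intro on_model_eqI) (simp_all add: p'(2)[symmetric] \<tau>_def[symmetric])
  have 3: "on_model \<sigma> (f + g) = on_model \<sigma> f + on_model \<sigma> g" "on_model \<sigma> (f * g) = on_model \<sigma> f * on_model \<sigma> g"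
    if "f \<in> M" "g \<in> M" for f g
    using ring_hom_add[OF hom car[OF that(1)] car[OF that(2)]]
      ring_hom_mult[OF hom car[OF that(1)] car[OF that(2)]] that
    by (auto intro!: on_model_eqI simp: surface_ring_ops p M_closed)
  have 4: "on_model \<sigma> (scal a) = scal a" for a by (rule on_model_eqI) (simp_all add: const)
  show ?thesis
    unfolding is_aut_def \<tau>_def[symmetric] using p(1) p'(1) 1 2 3 4 by simp
qed

lemma isotropy_trivial:
  assumes D: "D \<in> derivations (surface_ring c q) (surface_const c q)"
    and simple: "simple_derivation (surface_ring c q) D"
    and nz: "coeff_xy q 0 0 \<noteq> 0" "coeff_xy q 0 1 \<noteq> 0" "coeff_xy q 1 0 \<noteq> 0"
  shows "isotropy (surface_ring c q) (surface_const c q) D =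
    {\<lambda>f\<in>carrier (surface_ring c q). f}"
proof (intro equalityI subsetI)
  fix \<sigma> assume "\<sigma> \<in> isotropy (surface_ring c q) (surface_const c q) D"
  then have \<sigma>: "\<sigma> \<in> algebra_auts (surface_ring c q) (surface_const c q)"
    and comm: "\<And>K. K \<in> carrier (surface_ring c q) \<Longrightarrow> \<sigma> (D K) = D (\<sigma> K)"
    by (auto simp: isotropy_def)
  have Pi: "D \<in> carrier (surface_ring c q) \<rightarrow> carrier (surface_ring c q)"
    using D by (auto simp: derivations_def PiE_iff)
  have Pi': "\<sigma> \<in> carrier (surface_ring c q) \<rightarrow> carrier (surface_ring c q)"
    and ext: "\<sigma> \<in> extensional (carrier (surface_ring c q))"
    using \<sigma> by (auto simp: algebra_auts_def ring_iso_def bij_betw_def)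
  have "on_model \<sigma> f = f" if f: "f \<in> M" for f
  proof (rule model_isotropy_trivial[OF is_aut_on_model[OF \<sigma>] is_der_on_model[OF D] is_simple_on_model[OF Pi simple] _ nz f])
    fix g assume g: "g \<in> M"
    have "\<sigma> (D (fibre g)) = D (\<sigma> (fibre g))" using g by (intro comm) (simp add: carrier_surface_ring)
    then show "on_model \<sigma> (on_model D g) = on_model D (on_model \<sigma> g)"
      using g by (simp add: on_model[OF Pi] on_model[OF Pi'] fibre_inj)
  qed
  then have "\<sigma> K = K" if "K \<in> carrier (surface_ring c q)" for K
    using that on_model(2)[OF Pi'] by (auto simp: carrier_surface_ring)
  then show "\<sigma> \<in> {\<lambda>f\<in>carrier (surface_ring c q). f}"
    using ext by (auto simp: extensional_def restrict_def fun_eq_iff)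
next
  interpret A: cring "surface_ring c q" by (rule cring_surface_ring)
  fix \<sigma> assume "\<sigma> \<in> {\<lambda>f\<in>carrier (surface_ring c q). f}"
  then have \<sigma>: "\<sigma> = (\<lambda>f\<in>carrier (surface_ring c q). f)" by simp
  have const: "surface_const c q a \<in> carrier (surface_ring c q)" for a
    by (simp add: surface_const_eq carrier_surface_ring)
  have Dc: "D K \<in> carrier (surface_ring c q)" if "K \<in> carrier (surface_ring c q)" for K
    using D that by (auto simp: derivations_def)
  have "\<sigma> \<in> ring_hom (surface_ring c q) (surface_ring c q)"
    unfolding \<sigma> by (rule ring_hom_memI) auto
  moreover have "bij_betw \<sigma> (carrier (surface_ring c q)) (carrier (surface_ring c q))"
    unfolding \<sigma> by (auto simp: bij_betw_def inj_on_def)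
  ultimately show "\<sigma> \<in> isotropy (surface_ring c q) (surface_const c q) D"
    using const Dc by (auto simp: isotropy_def algebra_auts_def ring_iso_def \<sigma>)
qed

end

section \<open>Reduced pairs\<close>

lemma reduced_pair_danielewski:
  fixes c :: "'k::field_char_0 poly"
  assumes n: "n \<ge> 2" and d: "d \<ge> 2" and "reduced_pair n d c q"
  obtains l where "danielewski n d c q l"
proof -
  obtain l a where c: "degree c = n" "coeff c (n - 1) = 0" and l: "l \<noteq> 0"
    and q: "q = monom [:l:] d + (\<Sum>i<n. \<Sum>j<d - 1. monom (monom (a i j) i) j)"
    using assms(3) unfolding reduced_pair_def by blast
  have cq: "coeff q k = (if k = d then [:l:] else 0) + (if k < d - 1 then \<Sum>i<n. monom (a i k) i else 0)" for k
  proof -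
    have "(\<Sum>j<d - 1. coeff (monom (monom (a i j) i) j) k) = (if k < d - 1 then monom (a i k) i else 0)" for i
      by (subst coeff_monom) (simp add: sum.delta)
    then show ?thesis by (simp add: q coeff_sum coeff_monom)
  qed
  have "degree q = d"
    using cq[of d] l by (intro antisym degree_le le_degree allI impI) (auto simp: cq)
  moreover have "degree (coeff q j) < n" if "j < d" for j
  proof -
    have "degree (\<Sum>i<n. monom (a i j) i) < n"
      using n by (intro degree_sum_less) (auto intro: le_less_trans[OF degree_monom_le])
    then show ?thesis using that n by (simp add: cq)
  qed
  ultimately have "danielewski n d c q l"
    using n d c l cq[of d] cq[of "d - 1"] by unfold_locales simp_all
  then show thesis by (rule that)
qed

theorem corollary14:
  fixes n d :: nat
    and c :: "'k::{alg_closed_field, field_char_0} poly"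
    and q :: "'k poly poly"
    and D :: "'k poly poly poly set \<Rightarrow> 'k poly poly poly set"
  assumes "n \<ge> 2" and "d \<ge> 3"
    and "(c, q) \<in> Omega n d"
    and "D \<in> derivations (surface_ring c q) (surface_const c q)"
    and "simple_derivation (surface_ring c q) D"
  shows "isotropy (surface_ring c q) (surface_const c q) D =
           {\<lambda>f\<in>carrier (surface_ring c q). f}"
proof -
  have "reduced_pair n d c q" and nz: "coeff_xy q 0 0 \<noteq> 0" "coeff_xy q 0 1 \<noteq> 0" "coeff_xy q 1 0 \<noteq> 0"
    using assms(3) by (auto simp: Omega_def)
  then obtain l where "danielewski n d c q l"
    using reduced_pair_danielewski[of n d c q] assms(1,2) by auto
  then show ?thesis using danielewski.isotropy_trivial assms(4,5) nz by blast
qed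

end
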